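(* Let $n\geq 3$ and $\mathbf{q}=(q_0,\dots,q_{n-1}),\mathbf{p}=(p_0,\dots,p_{n-1})\in(\Bbbk^\times)^n$. Then $A_n(\mathbf{q})\cong A_n(\mathbf{p})$ if and only if there exist $\alpha_0,\dots,\alpha_{n-1}\in\Bbbk^\times$ and $0\le k<n$ such that either (1) $p_i=\frac{\alpha_{i+k-1}}{\alpha_{i+k}}q_{i+k}$ for all $0\le i<n$, or (2) $p_i=\frac{\alpha_{n-i-k}}{\alpha_{n-i-k-1}}q_{n-i-k}^{-1}$ for all $0\le i<n$ (indices taken modulo $n$).
   Context: $\Bbbk$ is an algebraically closed field of characteristic zero. Paths are written left to right ($xy$ means $x$ then $y$). For $\mathbf{q}\in(\Bbbk^\times)^n$, $A_n(\mathbf{q})=\Bbbk Q/(a_ia_i^*-q_ia_{i-1}^*a_{i-1},\ i=0,\dots,n-1)$, where $Q$ has vertices $e_0,\dots,e_{n-1}$ and arrows $a_i:e_i\to e_{i+1}$ and $a_i^*:e_{i+1}\to e_i$ for $i=0,\dots,n-1$, indices modulo $n$. *)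

theory Defs
  imports "HOL-Algebra.QuotRing" "HOL-Computational_Algebra.Polynomial"
begin

definition alg_closed :: "'k::field itself \<Rightarrow> bool" where
  "alg_closed _ \<longleftrightarrow> (\<forall>p :: 'k poly. degree p > 0 \<longrightarrow> (\<exists>x. poly p x = 0))"

text \<open>Arrows of the quiver Q (n vertices 0..n-1): (i, False) is a_i : e_i -> e_{i+1},
  (i, True) is a_i^* : e_{i+1} -> e_i (indices mod n).\<close>
type_synonym arrow = "nat \<times> bool"

fun asrc :: "nat \<Rightarrow> arrow \<Rightarrow> nat" where
  "asrc n (i, False) = i"
| "asrc n (i, True) = Suc i mod n"

fun atgt :: "nat \<Rightarrow> arrow \<Rightarrow> nat" where
  "atgt n (i, False) = Suc i mod n"
| "atgt n (i, True) = i"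

text \<open>Paths written left to right: a start vertex and a list of arrows (empty list = e_v).
  walk returns the terminal vertex if the arrows are composable.\<close>
type_synonym qpath = "nat \<times> arrow list"

fun walk :: "nat \<Rightarrow> nat \<Rightarrow> arrow list \<Rightarrow> nat option" where
  "walk n v [] = Some v"
| "walk n v (a # as) = (if asrc n a = v then walk n (atgt n a) as else None)"

definition valid_path :: "nat \<Rightarrow> qpath \<Rightarrow> bool" where
  "valid_path n p \<longleftrightarrow> fst p < n \<and> (\<forall>a\<in>set (snd p). fst a < n) \<and> walk n (fst p) (snd p) \<noteq> None"

text \<open>Concatenation xy (x then y); None means the product is zero.\<close>
definition pconcat :: "nat \<Rightarrow> qpath \<Rightarrow> qpath \<Rightarrow> qpath option" where
  "pconcat n x y = (if walk n (fst x) (snd x) = Some (fst y) then Some (fst x, snd x @ snd y) else None)"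

definition pa_carrier :: "nat \<Rightarrow> (qpath \<Rightarrow> 'k::field) set" where
  "pa_carrier n = {f. finite {x. f x \<noteq> 0} \<and> (\<forall>x. f x \<noteq> 0 \<longrightarrow> valid_path n x)}"

definition pa_mult :: "nat \<Rightarrow> (qpath \<Rightarrow> 'k::field) \<Rightarrow> (qpath \<Rightarrow> 'k) \<Rightarrow> qpath \<Rightarrow> 'k" where
  "pa_mult n f g = (\<lambda>x. \<Sum>(u, w) \<in> {(u, w). f u \<noteq> 0 \<and> g w \<noteq> 0 \<and> pconcat n u w = Some x}. f u * g w)"

definition pa_one :: "nat \<Rightarrow> qpath \<Rightarrow> 'k::field" where
  "pa_one n = (\<lambda>x. if snd x = [] \<and> fst x < n then 1 else 0)"

definition path_alg :: "nat \<Rightarrow> (qpath \<Rightarrow> 'k::field) ring" where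
  "path_alg n = \<lparr>carrier = pa_carrier n, monoid.mult = pa_mult n, one = pa_one n,
                  ring.zero = (\<lambda>_. 0), ring.add = (\<lambda>f g x. f x + g x)\<rparr>"

definition pa_scal :: "nat \<Rightarrow> 'k::field \<Rightarrow> qpath \<Rightarrow> 'k" where
  "pa_scal n c = (\<lambda>x. c * pa_one n x)"

definition rel_elem :: "nat \<Rightarrow> (nat \<Rightarrow> 'k::field) \<Rightarrow> nat \<Rightarrow> qpath \<Rightarrow> 'k" where
  "rel_elem n q i = (\<lambda>x.
     (if x = (i, [(i, False), (i, True)]) then 1 else 0)
     - q i * (if x = (i, [((i + n - 1) mod n, True), ((i + n - 1) mod n, False)]) then 1 else 0))"

definition rel_ideal :: "nat \<Rightarrow> (nat \<Rightarrow> 'k::field) \<Rightarrow> (qpath \<Rightarrow> 'k) set" where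
  "rel_ideal n q = genideal (path_alg n) {rel_elem n q i | i. i < n}"

definition A_alg :: "nat \<Rightarrow> (nat \<Rightarrow> 'k::field) \<Rightarrow> (qpath \<Rightarrow> 'k) set ring" where
  "A_alg n q = path_alg n Quot rel_ideal n q"

text \<open>Isomorphism of k-algebras: a ring isomorphism of the quotients that is k-linear,
  i.e. fixes the classes of scalars.\<close>
definition A_iso :: "nat \<Rightarrow> (nat \<Rightarrow> 'k::field) \<Rightarrow> (nat \<Rightarrow> 'k) \<Rightarrow> bool" where
  "A_iso n q p \<longleftrightarrow> (\<exists>h. h \<in> ring_iso (A_alg n q) (A_alg n p) \<and>
     (\<forall>c. h (rel_ideal n q +>\<^bsub>path_alg n\<^esub> pa_scal n c) = rel_ideal n p +>\<^bsub>path_alg n\<^esub> pa_scal n c))"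

end

theory Submission
  imports Defs
begin

text \<open>
  The isomorphism class of \<open>A\<^sub>n(q)\<close> depends only on the product of the \<open>q\<^sub>i\<close>, up to inversion, and
  both conditions of the theorem say that the products for \<open>p\<close> and \<open>q\<close> are equal or inverse to each
  other: the factors \<open>\<alpha>\<close> telescope around the cycle.

  Rescaling the arrows \<open>a\<^sub>i\<close>, possibly combined with the reflection of the cyclic quiver, realises
  every such pair. Conversely, as no arrow is a loop, the only characters of \<open>A\<^sub>n(p)\<close> are the
  \<open>n\<close> vertex coefficients, so an isomorphism permutes them by some \<open>\<sigma>\<close> and hence preserves the arrow
  ideal \<open>J\<close>. Its effect on \<open>J/J\<^sup>2\<close> forces \<open>\<sigma>\<close> to preserve adjacency, so for \<open>n \<ge> 3\<close> it is a rotation or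
  a reflection, and each arrow goes to a multiple of the corresponding arrow. Comparing the relations
  in \<open>J\<^sup>2/J\<^sup>3\<close> gives \<open>p\<^sub>i \<beta>\<^sub>i = q\<^bsub>\<sigma> i\<^esub> \<beta>\<^bsub>i-1\<^esub>\<close> or \<open>\<gamma>\<^bsub>i-1\<^esub> = q\<^bsub>\<sigma> i\<^esub> p\<^sub>i \<gamma>\<^sub>i\<close> with nonzero factors, and
  the product over \<open>i\<close> finishes the proof.
\<close>

declare split_paired_All [simp del] split_paired_Ex [simp del]

section \<open>The path algebra\<close>

text \<open>A factorization of a path is determined by its cut: the second factor has to start where
  the first one ends. There are finitely many cuts whatever the supports, so additivity and
  associativity hold for arbitrary coefficient functions.\<close>

lemma pa_mult_eq_sum_split:
  "pa_mult n f g (v, as) =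
    (\<Sum>k\<le>length as. case walk n v (take k as) of None \<Rightarrow> 0 | Some u \<Rightarrow> f (v, take k as) * g (u, drop k as))"
proof -
  let ?S = "{(u, w). f u \<noteq> 0 \<and> g w \<noteq> 0 \<and> pconcat n u w = Some (v, as)}"
  let ?K = "{k. k \<le> length as \<and> walk n v (take k as) \<noteq> None}"
  let ?t = "\<lambda>k. f (v, take k as) * g (the (walk n v (take k as)), drop k as)"
  let ?h = "\<lambda>k. ((v, take k as), (the (walk n v (take k as)), drop k as))"
  have inj: "inj_on ?h ?K"
  proof (rule inj_onI)
    fix k l assume "k \<in> ?K" "l \<in> ?K" "?h k = ?h l"
    then have "length (take k as) = length (take l as)" "k \<le> length as" "l \<le> length as" by auto
    then show "k = l" by simp
  qed
  have sub: "?S \<subseteq> ?h ` ?K"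
  proof
    fix z assume "z \<in> ?S"
    then obtain u1 u2 w1 w2 where z: "z = ((u1, u2), (w1, w2))"
      and c: "pconcat n (u1, u2) (w1, w2) = Some (v, as)" by (cases z) auto
    from c have "walk n u1 u2 = Some w1" "u1 = v" "as = u2 @ w2"
      by (auto simp: pconcat_def split: if_splits)
    then show "z \<in> ?h ` ?K" unfolding z
      by (intro image_eqI[where x = "length u2"]) auto
  qed
  have "pa_mult n f g (v, as) = (\<Sum>(u, w)\<in>?S. f u * g w)" by (simp add: pa_mult_def)
  also have "\<dots> = (\<Sum>(u, w)\<in>?h ` ?K. f u * g w)"
    by (rule sum.mono_neutral_left) (use sub in \<open>auto simp: pconcat_def\<close>)
  also have "\<dots> = (\<Sum>k\<in>?K. ?t k)"
    by (subst sum.reindex[OF inj]) simp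
  also have "\<dots> = (\<Sum>k\<in>?K. case walk n v (take k as) of None \<Rightarrow> 0 | Some u \<Rightarrow> f (v, take k as) * g (u, drop k as))"
    by (rule sum.cong) auto
  also have "\<dots> = (\<Sum>k\<le>length as. case walk n v (take k as) of None \<Rightarrow> 0 | Some u \<Rightarrow> f (v, take k as) * g (u, drop k as))"
    by (rule sum.mono_neutral_left) auto
  finally show ?thesis .
qed

lemma pa_mult_Nil [simp]: "pa_mult n f g (v, []) = f (v, []) * g (v, [])"
  by (simp add: pa_mult_eq_sum_split)

text \<open>The cut at 0 gives the first term; every other cut leaves \<open>a\<close> in the left
  factor, and removing it there leaves a product over a shorter path. Inductions over paths run on
  this recursion.\<close>

lemma pa_mult_Cons:
  "pa_mult n f g (v, a # as) = f (v, []) * g (v, a # as) +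
     (if asrc n a = v then pa_mult n (\<lambda>x. f (v, a # snd x)) g (atgt n a, as) else 0)"
  by (simp add: pa_mult_eq_sum_split sum.atMost_Suc_shift del: sum.atMost_Suc
      cong: option.case_cong)

lemma pa_mult_cong_left:
  assumes "\<And>l. f (v, l) = f' (v, l)"
  shows "pa_mult n f g (v, as) = pa_mult n f' g (v, as)"
  unfolding pa_mult_eq_sum_split using assms by (simp cong: option.case_cong)

lemma pa_mult_add_left:
  "pa_mult n (\<lambda>x. f x + g x) h y = pa_mult n f h y + pa_mult n g h y"
  by (cases y) (auto simp: pa_mult_eq_sum_split sum.distrib[symmetric] algebra_simps split: option.split
      intro!: sum.cong)

lemma pa_mult_add_right:
  "pa_mult n h (\<lambda>x. f x + g x) y = pa_mult n h f y + pa_mult n h g y"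
  by (cases y) (auto simp: pa_mult_eq_sum_split sum.distrib[symmetric] algebra_simps split: option.split
      intro!: sum.cong)

lemma pa_mult_cmult_left:
  "pa_mult n (\<lambda>x. c * f x) g y = c * pa_mult n f g y"
  by (cases y) (auto simp: pa_mult_eq_sum_split sum_distrib_left algebra_simps split: option.split
      intro!: sum.cong)

lemma pa_mult_zero_left [simp]: "pa_mult n (\<lambda>x. 0) g y = 0"
  using pa_mult_cmult_left[of n 0 "\<lambda>x. 0" g y] by simp

lemma pa_mult_assoc_at:
  "pa_mult n (pa_mult n f g) h (v, as) = pa_mult n f (pa_mult n g h) (v, as)"
proof (induction as arbitrary: f v)
  case Nil
  then show ?case by simp
next
  case (Cons a as)
  \<comment> \<open>Stripped of its first arrow, the product is a multiple of the stripped
    \<open>g\<close> plus a product with the stripped \<open>f\<close>, to which the induction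
    hypothesis applies.\<close>
  have "pa_mult n (\<lambda>x. pa_mult n f g (v, a # snd x)) h (atgt n a, as) =
      pa_mult n (\<lambda>x. f (v, []) * g (v, a # snd x) + pa_mult n (\<lambda>x. f (v, a # snd x)) g x) h (atgt n a, as)"
    if "asrc n a = v"
    by (rule pa_mult_cong_left) (simp add: pa_mult_Cons that)
  then show ?case
    by (simp add: pa_mult_Cons pa_mult_add_left pa_mult_cmult_left Cons.IH algebra_simps)
qed

lemma pa_mult_assoc: "pa_mult n (pa_mult n f g) h = pa_mult n f (pa_mult n g h)"
proof
  show "pa_mult n (pa_mult n f g) h x = pa_mult n f (pa_mult n g h) x" for x
    by (cases x) (simp only: pa_mult_assoc_at)
qed

section \<open>Composable paths and elements of finite support\<close>

lemma walk_append:
  "walk n v (as @ bs) = (case walk n v as of None \<Rightarrow> None | Some u \<Rightarrow> walk n u bs)"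
  by (induction as arbitrary: v) auto

lemma atgt_less: "fst a < n \<Longrightarrow> atgt n a < n"
  by (cases "(n, a)" rule: atgt.cases) auto

lemma valid_path_Nil [simp]: "valid_path n (v, []) \<longleftrightarrow> v < n"
  by (simp add: valid_path_def)

lemma valid_path_Cons:
  "valid_path n (v, a # as) \<longleftrightarrow> v < n \<and> fst a < n \<and> asrc n a = v \<and> valid_path n (atgt n a, as)"
  by (auto simp: valid_path_def atgt_less)

lemma valid_path_concat:
  assumes "valid_path n u" "valid_path n w" "pconcat n u w = Some x"
  shows "valid_path n x"
  using assms by (fastforce simp: valid_path_def pconcat_def walk_append split: if_splits)

lemma pa_carrier_invalid: "f \<in> pa_carrier n \<Longrightarrow> \<not> valid_path n x \<Longrightarrow> f x = 0"
  by (auto simp: pa_carrier_def)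

lemma pa_mult_closed:
  assumes "f \<in> pa_carrier n" "g \<in> pa_carrier n"
  shows "pa_mult n f g \<in> pa_carrier n"
proof -
  let ?F = "{x. f x \<noteq> 0}" and ?G = "{x. g x \<noteq> 0}"
  have ex: "\<exists>u w. f u \<noteq> 0 \<and> g w \<noteq> 0 \<and> pconcat n u w = Some x" if "pa_mult n f g x \<noteq> 0" for x
  proof (rule ccontr)
    assume "\<not> ?thesis"
    then have "{(u, w). f u \<noteq> 0 \<and> g w \<noteq> 0 \<and> pconcat n u w = Some x} = {}" by auto
    then show False using that by (simp only: pa_mult_def) simp
  qed
  have "{x. pa_mult n f g x \<noteq> 0} \<subseteq> (\<lambda>(u, w). the (pconcat n u w)) ` (?F \<times> ?G)"
    using ex by force
  moreover have "finite (?F \<times> ?G)" using assms by (auto simp: pa_carrier_def)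
  ultimately have "finite {x. pa_mult n f g x \<noteq> 0}" by (meson finite_surj)
  moreover have "valid_path n x" if "pa_mult n f g x \<noteq> 0" for x
    using ex[OF that] assms valid_path_concat by (fastforce simp: pa_carrier_def)
  ultimately show ?thesis by (simp add: pa_carrier_def)
qed

lemma pa_add_closed:
  assumes "f \<in> pa_carrier n" "g \<in> pa_carrier n"
  shows "(\<lambda>x. f x + g x) \<in> pa_carrier n"
proof -
  have "{x. f x + g x \<noteq> 0} \<subseteq> {x. f x \<noteq> 0} \<union> {x. g x \<noteq> 0}" by auto
  then have "finite {x. f x + g x \<noteq> 0}"
    using assms by (auto simp: pa_carrier_def intro: finite_subset)
  moreover have "valid_path n x" if "f x + g x \<noteq> 0" for x
    using that assms by (rule_tac ccontr) (simp add: pa_carrier_invalid)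
  ultimately show ?thesis by (simp add: pa_carrier_def)
qed

lemma pa_cmult_closed:
  assumes "f \<in> pa_carrier n"
  shows "(\<lambda>x. c * f x) \<in> pa_carrier n"
proof -
  have "{x. c * f x \<noteq> 0} \<subseteq> {x. f x \<noteq> 0}" by auto
  then have "finite {x. c * f x \<noteq> 0}"
    using assms by (auto simp: pa_carrier_def intro: finite_subset)
  then show ?thesis using assms by (auto simp: pa_carrier_def)
qed

lemma pa_diff_closed:
  assumes "f \<in> pa_carrier n" "g \<in> pa_carrier n"
  shows "(\<lambda>x. f x - g x) \<in> pa_carrier n"
  using pa_add_closed[OF assms(1) pa_cmult_closed[OF assms(2), of "-1"]] by simp

lemma pa_zero_closed: "(\<lambda>x. 0) \<in> pa_carrier n"
  by (simp add: pa_carrier_def)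

lemma pa_one_closed: "pa_one n \<in> pa_carrier n"
proof -
  have "{x. pa_one n x \<noteq> 0} = (\<lambda>v. (v, [])) ` {..<n}"
    by (auto simp: pa_one_def)
  then show ?thesis by (auto simp: pa_carrier_def pa_one_def split: if_splits)
qed

lemma pa_scal_closed: "pa_scal n c \<in> pa_carrier n"
  unfolding pa_scal_def by (rule pa_cmult_closed[OF pa_one_closed])

lemma pa_one_mult:
  assumes "f \<in> pa_carrier n"
  shows "pa_mult n (pa_one n) f = f"
proof
  fix x :: qpath
  obtain v as where x: "x = (v, as)" by (cases x)
  show "pa_mult n (pa_one n) f x = f x"
  proof (cases "valid_path n x")
    case True
    then show ?thesis
      by (cases as) (auto simp: x pa_mult_Cons pa_one_def valid_path_Cons)
  next
    case False
    then show ?thesis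
      using assms pa_mult_closed[OF pa_one_closed assms] by (simp add: pa_carrier_invalid)
  qed
qed

lemma pa_mult_one:
  assumes "f \<in> pa_carrier n"
  shows "pa_mult n f (pa_one n) = f"
proof
  fix x :: qpath
  \<comment> \<open>Stated for arbitrary \<open>g\<close>, because the recursion replaces the left
    factor by a stripped one, which may lie outside the carrier.\<close>
  have *: "valid_path n (v, as) \<Longrightarrow> pa_mult n g (pa_one n) (v, as) = g (v, as)" for g v as
    by (induction as arbitrary: g v) (auto simp: pa_one_def pa_mult_Cons valid_path_Cons)
  show "pa_mult n f (pa_one n) x = f x"
  proof (cases "valid_path n x")
    case True
    then show ?thesis using * by (metis surj_pair)
  next
    case False
    then show ?thesis
      using assms pa_mult_closed[OF assms pa_one_closed] by (simp add: pa_carrier_invalid)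
  qed
qed

text \<open>Through this identity a ring isomorphism that fixes the classes of scalars is
  linear.\<close>

lemma pa_scal_mult:
  assumes "f \<in> pa_carrier n"
  shows "pa_mult n (pa_scal n c) f = (\<lambda>x. c * f x)"
  using pa_one_mult[OF assms] by (auto simp: pa_scal_def pa_mult_cmult_left)

section \<open>The ring axioms and the basis of paths\<close>

lemma path_alg_simps [simp]:
  "carrier (path_alg n) = pa_carrier n" "monoid.mult (path_alg n) = pa_mult n" "one (path_alg n) = pa_one n"
  "ring.zero (path_alg n) = (\<lambda>_. 0)" "ring.add (path_alg n) = (\<lambda>f g x. f x + g x)"
  by (auto simp: path_alg_def)

lemma ring_path_alg: "ring (path_alg n :: (qpath \<Rightarrow> 'k::field) ring)"
proof (rule ringI)
  show "abelian_group (path_alg n :: (qpath \<Rightarrow> 'k) ring)"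
  proof (rule abelian_groupI; simp add: pa_add_closed pa_zero_closed add_ac)
    fix f :: "qpath \<Rightarrow> 'k" assume "f \<in> pa_carrier n"
    then have "(\<lambda>x. - f x) \<in> pa_carrier n" using pa_cmult_closed[of f n "-1"] by simp
    then show "\<exists>g\<in>pa_carrier n. (\<lambda>x. f x + g x) = (\<lambda>_. 0)" by (rule rev_bexI) simp
  qed
  show "Group.monoid (path_alg n :: (qpath \<Rightarrow> 'k) ring)"
    by (rule monoidI) (auto simp: pa_mult_closed pa_one_closed pa_one_mult pa_mult_one pa_mult_assoc)
qed (auto intro!: ext simp: pa_mult_add_left pa_mult_add_right)

lemma path_alg_minus:
  assumes "f \<in> pa_carrier n" "g \<in> pa_carrier n"
  shows "f \<ominus>\<^bsub>path_alg n\<^esub> g = (\<lambda>x. f x - g x)"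
proof -
  interpret ring "path_alg n" by (rule ring_path_alg)
  have "(\<lambda>x. - g x) \<in> pa_carrier n" using pa_cmult_closed[OF assms(2), of "-1"] by simp
  then have "\<ominus>\<^bsub>path_alg n\<^esub> g = (\<lambda>x. - g x)"
    using assms by (intro minus_equality) auto
  then show ?thesis by (simp add: a_minus_def)
qed

definition path_elem :: "qpath \<Rightarrow> qpath \<Rightarrow> 'k::field" where
  "path_elem x = (\<lambda>y. if y = x then 1 else 0)"

lemma path_elem_apply: "path_elem x y = (if y = x then 1 else 0)"
  by (simp add: path_elem_def)

lemma path_elem_closed: "valid_path n x \<Longrightarrow> path_elem x \<in> pa_carrier n"
  by (auto simp: pa_carrier_def path_elem_def)

lemma pa_mult_path_elem:
  "pa_mult n (path_elem u) (path_elem w :: qpath \<Rightarrow> 'k::field) =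
    (case pconcat n u w of None \<Rightarrow> (\<lambda>_. 0) | Some x \<Rightarrow> path_elem x)"
proof
  fix y
  have S: "{(u', w'). path_elem u u' \<noteq> (0::'k) \<and> path_elem w w' \<noteq> (0::'k) \<and> pconcat n u' w' = Some y}
     = (if pconcat n u w = Some y then {(u, w)} else {})"
    by (auto simp: path_elem_def split: if_splits)
  show "pa_mult n (path_elem u) (path_elem w :: qpath \<Rightarrow> 'k) y =
    (case pconcat n u w of None \<Rightarrow> (\<lambda>_. 0) | Some x \<Rightarrow> path_elem x) y"
    unfolding pa_mult_def S by (auto simp: path_elem_def split: option.split)
qed

text \<open>The paths form a basis: induction over the finite support splits off one path at a
  time.\<close>

lemma pa_carrier_induct [consumes 1, case_names zero add]:
  assumes "f \<in> pa_carrier n"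
    and "P (\<lambda>_. 0)"
    and "\<And>x c g. valid_path n x \<Longrightarrow> g \<in> pa_carrier n \<Longrightarrow> P g \<Longrightarrow> P (\<lambda>y. c * path_elem x y + g y)"
  shows "P f"
proof -
  have "finite {x. f x \<noteq> 0}" using assms(1) by (simp add: pa_carrier_def)
  then show ?thesis using assms(1)
  proof (induction "{x. f x \<noteq> 0}" arbitrary: f rule: finite_induct)
    case empty
    then have "f = (\<lambda>_. 0)" by auto
    then show ?case using assms(2) by simp
  next
    case (insert x F)
    let ?g = "f(x := 0)"
    have F: "F = {y. ?g y \<noteq> 0}" using insert(2,4) by auto
    have g: "?g \<in> pa_carrier n" using insert.prems insert.hyps(1) F by (auto simp: pa_carrier_def)
    have "f x \<noteq> 0" using insert(4) by auto
    then have "valid_path n x" using insert.prems by (simp add: pa_carrier_def)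
    from assms(3)[OF this g insert.hyps(3)[OF F g], of "f x"]
    have "P (\<lambda>y. f x * path_elem x y + ?g y)" .
    also have "(\<lambda>y. f x * path_elem x y + ?g y) = f" by (auto simp: path_elem_def)
    finally show ?case .
  qed
qed

section \<open>The ideal of relations\<close>

definition vnext :: "nat \<Rightarrow> nat \<Rightarrow> nat" where
  "vnext n i = Suc i mod n"

definition vprev :: "nat \<Rightarrow> nat \<Rightarrow> nat" where
  "vprev n i = (i + n - 1) mod n"

lemma asrc_eq: "asrc n (i, b) = (if b then vnext n i else i)"
  and atgt_eq: "atgt n (i, b) = (if b then i else vnext n i)"
  by (cases b; simp add: vnext_def)+

lemma vnext_less: "0 < n \<Longrightarrow> vnext n i < n"
  and vprev_less: "0 < n \<Longrightarrow> vprev n i < n"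
  by (simp_all add: vnext_def vprev_def)

lemma vnext_if: "i < n \<Longrightarrow> vnext n i = (if Suc i = n then 0 else Suc i)"
  by (auto simp: vnext_def)

lemma vprev_if: "i < n \<Longrightarrow> vprev n i = (if i = 0 then n - 1 else i - 1)"
  by (cases i) (auto simp: vprev_def)

lemma vnext_vprev: "i < n \<Longrightarrow> vnext n (vprev n i) = i"
  and vprev_vnext: "i < n \<Longrightarrow> vprev n (vnext n i) = i"
  by (auto simp: vnext_if vprev_if vnext_less vprev_less)

text \<open>Rules out loops among the arrows; the second inequality keeps the two neighbours of a
  vertex apart, which fails for \<open>n = 2\<close>.\<close>

lemma vnext_neq: "i < n \<Longrightarrow> 2 \<le> n \<Longrightarrow> vnext n i \<noteq> i"
  and vnext_vnext_neq: "i < n \<Longrightarrow> 3 \<le> n \<Longrightarrow> vnext n (vnext n i) \<noteq> i"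
  by (auto simp: vnext_if vnext_less)

lemma bij_betw_vprev: "bij_betw (vprev n) {..<n} {..<n}"
  by (rule bij_betw_byWitness[where f' = "vnext n"]) (auto simp: vnext_vprev vprev_vnext vnext_less vprev_less)

section \<open>The relations and their ideal\<close>

definition out_loop :: "nat \<Rightarrow> qpath" where
  "out_loop i = (i, [(i, False), (i, True)])"

definition in_loop :: "nat \<Rightarrow> nat \<Rightarrow> qpath" where
  "in_loop n i = (i, [(vprev n i, True), (vprev n i, False)])"

lemma rel_elem_eq:
  "rel_elem n q i = (\<lambda>x. path_elem (out_loop i) x - q i * path_elem (in_loop n i) x)"
  unfolding rel_elem_def path_elem_def out_loop_def in_loop_def vprev_def by simp

lemma valid_loops: "i < n \<Longrightarrow> valid_path n (out_loop i)" "i < n \<Longrightarrow> valid_path n (in_loop n i)"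
  by (simp_all add: out_loop_def in_loop_def valid_path_Cons asrc_eq atgt_eq vnext_less vprev_less vnext_vprev)

lemma rel_elem_closed: "i < n \<Longrightarrow> rel_elem n q i \<in> pa_carrier n"
  unfolding rel_elem_eq by (intro pa_diff_closed pa_cmult_closed path_elem_closed valid_loops)

lemma ideal_rel_ideal: "ideal (rel_ideal n q) (path_alg n)"
  unfolding rel_ideal_def by (rule ring.genideal_ideal[OF ring_path_alg]) (auto simp: rel_elem_closed)

lemma rel_elem_in_rel_ideal: "i < n \<Longrightarrow> rel_elem n q i \<in> rel_ideal n q"
  unfolding rel_ideal_def
  by (rule subsetD[OF ring.genideal_self[OF ring_path_alg]]) (auto simp: rel_elem_closed)

lemma rel_ideal_minimal:
  "ideal I (path_alg n) \<Longrightarrow> (\<And>i. i < n \<Longrightarrow> rel_elem n q i \<in> I) \<Longrightarrow> rel_ideal n q \<subseteq> I"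
  unfolding rel_ideal_def by (rule ring.genideal_minimal[OF ring_path_alg]) auto

lemma rel_coset_eq_iff:
  assumes "f \<in> pa_carrier n" "g \<in> pa_carrier n"
  shows "rel_ideal n q +>\<^bsub>path_alg n\<^esub> f = rel_ideal n q +>\<^bsub>path_alg n\<^esub> g \<longleftrightarrow> (\<lambda>x. f x - g x) \<in> rel_ideal n q"
  using ring.quotient_eq_iff_same_a_r_cos[OF ring_path_alg ideal_rel_ideal, of f n g q] assms
  by (simp add: path_alg_minus)

section \<open>Invariants in degree at most two\<close>

text \<open>The functional \<open>loop_coeff n p i\<close> vanishes on the relation at vertex \<open>i\<close>, and therefore the
  relations of \<open>A\<^sub>n(p)\<close> are invisible to the data compared by \<open>low_equal\<close>.\<close>

definition loop_coeff :: "nat \<Rightarrow> (nat \<Rightarrow> 'k::field) \<Rightarrow> nat \<Rightarrow> (qpath \<Rightarrow> 'k) \<Rightarrow> 'k" where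
  "loop_coeff n p i f = p i * f (out_loop i) + f (in_loop n i)"

definition low_equal :: "nat \<Rightarrow> (nat \<Rightarrow> 'k::field) \<Rightarrow> (qpath \<Rightarrow> 'k) \<Rightarrow> (qpath \<Rightarrow> 'k) \<Rightarrow> bool" where
  "low_equal n p f g \<longleftrightarrow> (\<forall>v. f (v, []) = g (v, [])) \<and> (\<forall>v a. f (v, [a]) = g (v, [a])) \<and>
     (\<forall>i<n. loop_coeff n p i f = loop_coeff n p i g)"

lemma pa_mult_single:
  "pa_mult n f g (v, [a]) = f (v, []) * g (v, [a]) + (if asrc n a = v then f (v, [a]) * g (atgt n a, []) else 0)"
  by (simp add: pa_mult_Cons)

lemma pa_mult_out_loop:
  "pa_mult n f g (out_loop i) = f (i, []) * g (out_loop i) +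
     f (i, [(i, False)]) * g (vnext n i, [(i, True)]) + f (out_loop i) * g (i, [])"
  by (simp add: out_loop_def pa_mult_Cons asrc_eq atgt_eq)

lemma pa_mult_in_loop:
  "i < n \<Longrightarrow> pa_mult n f g (in_loop n i) = f (i, []) * g (in_loop n i) +
     f (i, [(vprev n i, True)]) * g (vprev n i, [(vprev n i, False)]) + f (in_loop n i) * g (i, [])"
  by (simp add: in_loop_def pa_mult_Cons asrc_eq atgt_eq vnext_vprev)

text \<open>A path of length two has three cuts. The outer ones reassemble \<open>loop_coeff\<close>
  of a factor and the middle one sees only arrow coefficients, so the value depends only on data
  that \<open>low_equal\<close> compares.\<close>

lemma loop_coeff_mult:
  assumes "i < n"
  shows "loop_coeff n p i (pa_mult n f g) = f (i, []) * loop_coeff n p i g + loop_coeff n p i f * g (i, []) +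
    p i * f (i, [(i, False)]) * g (vnext n i, [(i, True)]) +
    f (i, [(vprev n i, True)]) * g (vprev n i, [(vprev n i, False)])"
  unfolding loop_coeff_def pa_mult_out_loop pa_mult_in_loop[OF assms] by (simp add: algebra_simps)

text \<open>Each low coefficient of a product is a sum of terms containing a low coefficient of both
  factors, so it vanishes as soon as those of one factor do.\<close>

lemma ideal_low:
  "ideal {f \<in> pa_carrier n. low_equal n p f (\<lambda>_. 0)} (path_alg n)"
proof (rule idealI[OF ring_path_alg])
  interpret R: ring "path_alg n" by (rule ring_path_alg)
  show "subgroup {f \<in> pa_carrier n. low_equal n p f (\<lambda>_. 0)} (add_monoid (path_alg n))"
  proof (rule R.add.subgroupI)
    fix f assume f: "f \<in> {f \<in> pa_carrier n. low_equal n p f (\<lambda>_. 0)}"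
    have m: "(\<lambda>x. - f x) \<in> pa_carrier n"
      using f pa_cmult_closed[of f n "-1"] by simp
    have "\<ominus>\<^bsub>path_alg n\<^esub> f = (\<lambda>x. - f x)"
      using f m by (intro R.minus_equality) auto
    then show "\<ominus>\<^bsub>path_alg n\<^esub> f \<in> {f \<in> pa_carrier n. low_equal n p f (\<lambda>_. 0)}"
      using f m by (auto simp: low_equal_def loop_coeff_def neg_eq_iff_add_eq_0)
  next
    fix f g assume "f \<in> {f \<in> pa_carrier n. low_equal n p f (\<lambda>_. 0)}" "g \<in> {f \<in> pa_carrier n. low_equal n p f (\<lambda>_. 0)}"
    moreover have "loop_coeff n p i (\<lambda>x. f x + g x) = loop_coeff n p i f + loop_coeff n p i g" for i
      by (simp add: loop_coeff_def algebra_simps)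
    ultimately show "f \<oplus>\<^bsub>path_alg n\<^esub> g \<in> {f \<in> pa_carrier n. low_equal n p f (\<lambda>_. 0)}"
      by (simp add: low_equal_def pa_add_closed) (simp add: loop_coeff_def)
  qed (use pa_zero_closed in \<open>auto simp: low_equal_def\<close>)
  show "x \<otimes>\<^bsub>path_alg n\<^esub> a \<in> {f \<in> pa_carrier n. low_equal n p f (\<lambda>_. 0)}"
    and "a \<otimes>\<^bsub>path_alg n\<^esub> x \<in> {f \<in> pa_carrier n. low_equal n p f (\<lambda>_. 0)}"
    if "a \<in> {f \<in> pa_carrier n. low_equal n p f (\<lambda>_. 0)}" "x \<in> carrier (path_alg n)" for a x
    using that by (auto simp: low_equal_def pa_mult_closed pa_mult_single loop_coeff_mult)
      (auto simp: loop_coeff_def)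
qed

text \<open>The ideal of elements with vanishing low data contains every relation, as
  \<open>loop_coeff\<close> is \<open>p i - p i\<close> on the one at \<open>i\<close>. It therefore
  contains the relation ideal, and low data are well defined on classes.\<close>

lemma low_equal_if_diff_in_rel_ideal:
  assumes "(\<lambda>x. f x - g x) \<in> rel_ideal n p"
  shows "low_equal n p f g"
proof -
  have "rel_elem n p i \<in> {f \<in> pa_carrier n. low_equal n p f (\<lambda>_. 0)}" if "i < n" for i
    using that rel_elem_closed[OF that, of p]
    by (auto simp: low_equal_def loop_coeff_def rel_elem_eq path_elem_def out_loop_def in_loop_def)
  with assms rel_ideal_minimal[OF ideal_low] have "low_equal n p (\<lambda>x. f x - g x) (\<lambda>_. 0)" by blast
  moreover have "loop_coeff n p i (\<lambda>x. f x - g x) = loop_coeff n p i f - loop_coeff n p i g" for i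
    by (simp add: loop_coeff_def algebra_simps)
  ultimately show ?thesis
    by (simp add: low_equal_def) (simp add: loop_coeff_def)
qed

section \<open>Representatives for an isomorphism of the quotients\<close>

lemma FactRing_carrier: "carrier (R Quot I) = (\<lambda>a. I +>\<^bsub>R\<^esub> a) ` carrier R"
  by (auto simp: FactRing_simps)

lemma FactRing_hom_coset:
  assumes "ideal I R" "ideal J R" "h \<in> ring_hom (R Quot I) (R Quot J)" "a \<in> carrier R"
  shows "\<exists>b\<in>carrier R. h (I +>\<^bsub>R\<^esub> a) = J +>\<^bsub>R\<^esub> b"
proof -
  interpret I: ideal I R by fact
  have "I +>\<^bsub>R\<^esub> a \<in> carrier (R Quot I)"
    using assms(4) I.rcos_ring_hom by (auto dest: ring_hom_closed)
  then have "h (I +>\<^bsub>R\<^esub> a) \<in> carrier (R Quot J)" using assms(3) by (auto dest: ring_hom_closed)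
  then show ?thesis by (auto simp: FactRing_carrier)
qed

text \<open>\<open>H\<close> picks a representative of the image of a class. It respects the
  operations only modulo the relations of \<open>A_alg n p\<close>, so the axioms record what
  survives in low degree; \<open>q\<close> enters through its relations being killed.\<close>

locale low_degree_lift =
  fixes n :: nat and p q :: "nat \<Rightarrow> 'k::field" and H :: "(qpath \<Rightarrow> 'k) \<Rightarrow> qpath \<Rightarrow> 'k"
  assumes n3: "3 \<le> n"
    and H_mult: "\<lbrakk>f \<in> pa_carrier n; g \<in> pa_carrier n\<rbrakk> \<Longrightarrow> low_equal n p (H (pa_mult n f g)) (pa_mult n (H f) (H g))"
    and H_add: "\<lbrakk>f \<in> pa_carrier n; g \<in> pa_carrier n\<rbrakk> \<Longrightarrow> low_equal n p (H (\<lambda>x. f x + g x)) (\<lambda>x. H f x + H g x)"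
    and H_cmult: "f \<in> pa_carrier n \<Longrightarrow> low_equal n p (H (\<lambda>x. c * f x)) (\<lambda>x. c * H f x)"
    and H_one: "low_equal n p (H (pa_one n)) (pa_one n)"
    and H_rel: "i < n \<Longrightarrow> low_equal n p (H (rel_elem n q i)) (\<lambda>_. 0)"
    and H_surj: "g \<in> pa_carrier n \<Longrightarrow> \<exists>f\<in>pa_carrier n. low_equal n p (H f) g"

text \<open>Two representatives of one class differ by an element of the relation ideal and are thus
  \<open>low_equal\<close>, so every axiom reduces to an identity between classes.\<close>

lemma A_iso_imp_lift:
  assumes "A_iso n q p" "3 \<le> n"
  shows "\<exists>H. low_degree_lift n p q H"
proof -
  let ?R = "path_alg n :: (qpath \<Rightarrow> 'a) ring"
  let ?I = "rel_ideal n q" and ?J = "rel_ideal n p"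
  let ?cI = "a_r_coset ?R ?I" and ?cJ = "a_r_coset ?R ?J"
  obtain h where iso: "h \<in> ring_iso (?R Quot ?I) (?R Quot ?J)" and scal: "\<And>c. h (?cI (pa_scal n c)) = ?cJ (pa_scal n c)"
    using assms(1) unfolding A_iso_def A_alg_def by blast
  have h: "h \<in> ring_hom (?R Quot ?I) (?R Quot ?J)"
    using iso by (simp add: ring_iso_def)
  interpret R: ring ?R by (rule ring_path_alg)
  interpret I: ideal ?I ?R by (rule ideal_rel_ideal)
  interpret J: ideal ?J ?R by (rule ideal_rel_ideal)
  note I_hom = I.rcos_ring_hom and J_hom = J.rcos_ring_hom
  have I_closed: "?cI f \<in> carrier (?R Quot ?I)" if "f \<in> pa_carrier n" for f
    using that I_hom by (auto dest: ring_hom_closed)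
  have "\<forall>f. \<exists>g. f \<in> pa_carrier n \<longrightarrow> g \<in> pa_carrier n \<and> h (?cI f) = ?cJ g"
    using FactRing_hom_coset[OF I.is_ideal J.is_ideal h] by fastforce
  then obtain H where H_all: "\<forall>f. f \<in> pa_carrier n \<longrightarrow> H f \<in> pa_carrier n \<and> h (?cI f) = ?cJ (H f)"
    by (rule choice[THEN exE])
  then have H_closed: "H f \<in> pa_carrier n" and H: "h (?cI f) = ?cJ (H f)" if "f \<in> pa_carrier n" for f
    using that by auto
  have low: "low_equal n p (H f) g" if "f \<in> pa_carrier n" "g \<in> pa_carrier n" "h (?cI f) = ?cJ g" for f g
    using that H[OF that(1)] H_closed[OF that(1)] rel_coset_eq_iff[of "H f" n g p]
    by (auto intro: low_equal_if_diff_in_rel_ideal)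
  have hmult: "h (?cI (pa_mult n f g)) = ?cJ (pa_mult n f' g')"
    if "f \<in> pa_carrier n" "g \<in> pa_carrier n" "f' \<in> pa_carrier n" "g' \<in> pa_carrier n"
      "h (?cI f) = ?cJ f'" "h (?cI g) = ?cJ g'" for f g f' g'
    using that ring_hom_mult[OF I_hom, of f g] ring_hom_mult[OF J_hom, of f' g']
      ring_hom_mult[OF h I_closed I_closed, of f g] by simp
  have "low_degree_lift n p q H"
  proof
    show "3 \<le> n" by fact
    show "low_equal n p (H (pa_mult n f g)) (pa_mult n (H f) (H g))"
      if "f \<in> pa_carrier n" "g \<in> pa_carrier n" for f g
      using that by (intro low hmult pa_mult_closed H_closed H)
    show "low_equal n p (H (\<lambda>x. f x + g x)) (\<lambda>x. H f x + H g x)"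
      if "f \<in> pa_carrier n" "g \<in> pa_carrier n" for f g
      using that ring_hom_add[OF I_hom, of f g] ring_hom_add[OF J_hom, of "H f" "H g"]
        ring_hom_add[OF h I_closed I_closed, of f g]
      by (intro low pa_add_closed) (simp_all add: H_closed H)
    show "low_equal n p (H (\<lambda>x. c * f x)) (\<lambda>x. c * H f x)" if "f \<in> pa_carrier n" for f c
    proof (rule low)
      \<comment> \<open>Multiplication by \<open>c\<close> is multiplication by
        \<open>pa_scal n c\<close>, whose class is fixed.\<close>
      show "h (?cI (\<lambda>x. c * f x)) = ?cJ (\<lambda>x. c * H f x)"
        using hmult[OF pa_scal_closed that pa_scal_closed H_closed[OF that] scal H[OF that], of c]
        by (simp add: pa_scal_mult that H_closed)
    qed (use that in \<open>auto intro: pa_cmult_closed H_closed\<close>)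
    show "low_equal n p (H (pa_one n)) (pa_one n)"
      using scal[of 1] by (intro low pa_one_closed) (simp add: pa_scal_def)
    show "low_equal n p (H (rel_elem n q i)) (\<lambda>_. 0)" if "i < n" for i
    proof (rule low)
      \<comment> \<open>A relation has the class of the scalar 0.\<close>
      have "?cI (rel_elem n q i) = ?cI (pa_scal n 0)"
        by (subst rel_coset_eq_iff) (use that in \<open>auto simp: rel_elem_closed pa_scal_closed pa_zero_closed
            pa_scal_def rel_elem_in_rel_ideal\<close>)
      then show "h (?cI (rel_elem n q i)) = ?cJ (\<lambda>_. 0)" using scal[of 0] by (simp add: pa_scal_def)
    qed (use that in \<open>auto simp: rel_elem_closed pa_zero_closed\<close>)
    show "\<exists>f\<in>pa_carrier n. low_equal n p (H f) g" if g: "g \<in> pa_carrier n" for g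
    proof -
      have "?cJ g \<in> carrier (?R Quot ?J)" using g J_hom by (auto dest: ring_hom_closed)
      also have "\<dots> = h ` carrier (?R Quot ?I)" using iso by (auto simp: ring_iso_def bij_betw_def)
      finally obtain f where "f \<in> pa_carrier n" "?cJ g = h (?cI f)" by (auto simp: FactRing_carrier)
      then show ?thesis using low g by fastforce
    qed
  qed
  then show ?thesis by blast
qed

section \<open>The low-degree part of an isomorphism\<close>

abbreviation vert_elem :: "nat \<Rightarrow> qpath \<Rightarrow> 'k::field" where
  "vert_elem v \<equiv> path_elem (v, [])"

abbreviation arrow_elem :: "nat \<Rightarrow> arrow \<Rightarrow> qpath \<Rightarrow> 'k::field" where
  "arrow_elem n a \<equiv> path_elem (asrc n a, [a])"

lemma asrc_less: "fst a < n \<Longrightarrow> asrc n a < n"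
  by (cases a) (simp add: asrc_eq vnext_less)

lemma vert_elem_closed: "v < n \<Longrightarrow> vert_elem v \<in> pa_carrier n"
  by (simp add: path_elem_closed)

lemma arrow_elem_closed: "fst a < n \<Longrightarrow> arrow_elem n a \<in> pa_carrier n"
  by (simp add: path_elem_closed valid_path_Cons asrc_less atgt_less)

lemma vert_mult_vert: "pa_mult n (vert_elem v) (vert_elem w) = (if v = w then vert_elem v else (\<lambda>_. 0))"
  by (simp add: pa_mult_path_elem pconcat_def)

lemma vert_mult_path: "pa_mult n (vert_elem v) (path_elem (v, as)) = path_elem (v, as)"
  by (simp add: pa_mult_path_elem pconcat_def)

lemma arrow_mult_vert: "pa_mult n (arrow_elem n a) (vert_elem (atgt n a)) = arrow_elem n a"
  by (simp add: pa_mult_path_elem pconcat_def)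

lemma arrow_mult_path:
  "asrc n a = v \<Longrightarrow> pa_mult n (arrow_elem n a) (path_elem (atgt n a, as)) = path_elem (v, a # as)"
  by (auto simp: pa_mult_path_elem pconcat_def)

lemma out_loop_eq_mult: "path_elem (out_loop i) = pa_mult n (arrow_elem n (i, False)) (arrow_elem n (i, True))"
  by (simp add: pa_mult_path_elem pconcat_def out_loop_def asrc_eq atgt_eq)

lemma in_loop_eq_mult:
  "i < n \<Longrightarrow> path_elem (in_loop n i) = pa_mult n (arrow_elem n (vprev n i, True)) (arrow_elem n (vprev n i, False))"
  by (simp add: pa_mult_path_elem pconcat_def in_loop_def asrc_eq atgt_eq vnext_vprev)

lemma asrc_neq_atgt: "fst a < n \<Longrightarrow> 2 \<le> n \<Longrightarrow> asrc n a \<noteq> atgt n a"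
  using vnext_neq[of "fst a" n] by (cases a) (auto simp: asrc_eq atgt_eq)

lemma arrow_forward: "fst a < n \<Longrightarrow> 3 \<le> n \<Longrightarrow> atgt n a = vnext n (asrc n a) \<Longrightarrow> a = (asrc n a, False)"
  using vnext_vnext_neq[of "fst a" n] by (cases a) (auto simp: asrc_eq atgt_eq split: if_splits)

lemma arrow_backward: "fst a < n \<Longrightarrow> 3 \<le> n \<Longrightarrow> asrc n a = vnext n (atgt n a) \<Longrightarrow> a = (atgt n a, True)"
  using vnext_vnext_neq[of "fst a" n] by (cases a) (auto simp: asrc_eq atgt_eq split: if_splits)

section \<open>Characters and the permutation of the vertices\<close>

context low_degree_lift
begin

lemma n0: "0 < n" "2 \<le> n"
  using n3 by auto

text \<open>Taking the coefficient of a trivial path is linear and multiplicative, so composing it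
  with \<open>H\<close> gives characters.\<close>

lemma H_vertex:
  assumes "f \<in> pa_carrier n" "g \<in> pa_carrier n"
  shows "H (pa_mult n f g) (u, []) = H f (u, []) * H g (u, [])"
    and "H (\<lambda>x. c * f x + g x) (u, []) = c * H f (u, []) + H g (u, [])"
  using H_mult[OF assms] H_add[OF pa_cmult_closed[OF assms(1)] assms(2), of c] H_cmult[OF assms(1), of c]
  by (auto simp: low_equal_def)

text \<open>A Leibniz rule twisted by the characters at the two ends of \<open>b\<close>. The
  coefficient vanishes on products of elements whose images have no vertex part.\<close>

lemma H_arrow:
  assumes "f \<in> pa_carrier n" "g \<in> pa_carrier n"
  shows "H (pa_mult n f g) (asrc n b, [b]) =
      H f (asrc n b, []) * H g (asrc n b, [b]) + H f (asrc n b, [b]) * H g (atgt n b, [])"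
    and "H (\<lambda>x. c * f x + g x) (asrc n b, [b]) = c * H f (asrc n b, [b]) + H g (asrc n b, [b])"
  using H_mult[OF assms] H_add[OF pa_cmult_closed[OF assms(1)] assms(2), of c] H_cmult[OF assms(1), of c]
  by (auto simp: low_equal_def pa_mult_single)

lemma H_zero: "H (\<lambda>_. 0) (u, []) = 0" "H (\<lambda>_. 0) (asrc n b, [b]) = 0"
  using H_cmult[OF pa_zero_closed, of 0] by (auto simp: low_equal_def)

text \<open>A path is unchanged by its start vertex on the left, so a character that kills all
  vertices kills all paths. But its value at the unit is 1.\<close>

lemma ex_vertex:
  assumes "u < n"
  shows "\<exists>v<n. H (vert_elem v) (u, []) \<noteq> 0"
proof (rule ccontr)
  assume "\<not> ?thesis"
  then have z: "H (vert_elem v) (u, []) = 0" if "v < n" for v using that by blast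
  have "H f (u, []) = 0" if "f \<in> pa_carrier n" for f
    using that
  proof (induction f rule: pa_carrier_induct)
    case zero
    show ?case by (rule H_zero)
  next
    case (add x c g)
    obtain v as where x: "x = (v, as)" by (cases x)
    have v: "v < n" using add(1) by (simp add: x valid_path_def)
    have "H (path_elem x) (u, []) = H (vert_elem v) (u, []) * H (path_elem x) (u, [])"
      using H_vertex(1)[OF vert_elem_closed[OF v] path_elem_closed[OF add(1)], of u]
      by (simp add: x vert_mult_path)
    then have "H (path_elem x) (u, []) = 0" using z[OF v] by simp
    then show ?case using add H_vertex(2)[OF path_elem_closed[OF add(1)] add(2)] by simp
  qed
  from this[OF pa_one_closed] H_one show False
    using assms by (simp add: low_equal_def pa_one_def)
qed

text \<open>The choice is unique for \<open>u < n\<close>, by \<open>H_vert_vertex\<close>.\<close>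

definition \<sigma> :: "nat \<Rightarrow> nat" where
  "\<sigma> u = (SOME v. v < n \<and> H (vert_elem v) (u, []) \<noteq> 0)"

lemma \<sigma>: assumes "u < n" shows "\<sigma> u < n" "H (vert_elem (\<sigma> u)) (u, []) \<noteq> 0"
  using someI_ex[OF ex_vertex[OF assms, simplified]] unfolding \<sigma>_def by auto

text \<open>Vertices are orthogonal idempotents: values at distinct ones have product 0 and each
  value equals its square, so the nonzero one at \<open>\<sigma> u\<close> is 1.\<close>

lemma H_vert_vertex:
  assumes "u < n" "v < n"
  shows "H (vert_elem v) (u, []) = (if v = \<sigma> u then 1 else 0)"
proof -
  have "H (vert_elem v) (u, []) * H (vert_elem w) (u, []) = (if v = w then H (vert_elem v) (u, []) else 0)"
    if "w < n" for w
    using H_vertex(1)[OF vert_elem_closed[OF assms(2)] vert_elem_closed[OF that], of u]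
    by (simp add: vert_mult_vert H_zero split: if_splits)
  from this[OF \<sigma>(1)[OF assms(1)]] show ?thesis using \<sigma>[OF assms(1)] assms by (auto split: if_splits)
qed

text \<open>Multiplying the arrow by its source and its target does not change it. As these differ,
  the character at \<open>u\<close> kills one of them.\<close>

lemma H_arrow_elem_vertex:
  assumes "fst a < n" "u < n"
  shows "H (arrow_elem n a) (u, []) = 0"
proof -
  let ?x = "H (arrow_elem n a) (u, [])"
  have s: "asrc n a < n" "atgt n a < n" using assms asrc_less atgt_less by auto
  have "?x = H (vert_elem (asrc n a)) (u, []) * ?x"
    using H_vertex(1)[OF vert_elem_closed[OF s(1)] arrow_elem_closed[OF assms(1)], of u] by (simp add: vert_mult_path)
  moreover have "?x = ?x * H (vert_elem (atgt n a)) (u, [])"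
    using H_vertex(1)[OF arrow_elem_closed[OF assms(1)] vert_elem_closed[OF s(2)], of u] by (simp add: arrow_mult_vert)
  ultimately show ?thesis
    using asrc_neq_atgt[OF assms(1) n0(2)] s assms(2) by (auto simp: H_vert_vertex split: if_splits)
qed

lemma H_path_vertex:
  assumes "valid_path n (v, a # as)" "u < n"
  shows "H (path_elem (v, a # as)) (u, []) = 0"
proof -
  have a: "fst a < n" "asrc n a = v" "valid_path n (atgt n a, as)" using assms(1) by (auto simp: valid_path_Cons)
  show ?thesis
    using H_vertex(1)[OF arrow_elem_closed[OF a(1)] path_elem_closed[OF a(3)], of u] assms(2) a(1)
    by (simp add: arrow_mult_path[OF a(2)] H_arrow_elem_vertex)
qed

text \<open>Checked on the basis: a path of positive length is killed because its first arrow is. In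
  particular elements without vertex part have images without vertex part.\<close>

lemma H_at_vertex:
  assumes "f \<in> pa_carrier n" "u < n"
  shows "H f (u, []) = f (\<sigma> u, [])"
  using assms(1)
proof (induction f rule: pa_carrier_induct)
  case zero
  show ?case by (rule H_zero)
next
  case (add x c g)
  obtain v as where x: "x = (v, as)" by (cases x)
  have "H (path_elem x) (u, []) = path_elem x (\<sigma> u, [])"
    using add(1) assms(2) H_path_vertex
    by (cases as) (auto simp: x H_vert_vertex path_elem_apply[of _ "(\<sigma> u, [])"])
  then show ?case using add H_vertex(2)[OF path_elem_closed[OF add(1)] add(2)] by simp
qed

text \<open>By surjectivity some \<open>f\<close> has an image with the vertex part of
  \<open>vert_elem u\<close>. If \<open>\<sigma> u = \<sigma> w\<close>, the characters at
  \<open>u\<close> and \<open>w\<close> agree on \<open>f\<close>, which forces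
  \<open>u = w\<close>.\<close>

lemma bij_\<sigma>: "bij_betw \<sigma> {..<n} {..<n}"
proof -
  have "inj_on \<sigma> {..<n}"
  proof (rule inj_onI)
    fix u w assume uw: "u \<in> {..<n}" "w \<in> {..<n}" "\<sigma> u = \<sigma> w"
    from uw have "vert_elem u \<in> pa_carrier n" by (simp add: vert_elem_closed)
    from H_surj[OF this] obtain f where f: "f \<in> pa_carrier n" "low_equal n p (H f) (vert_elem u)" by blast
    then have "H f (u, []) = 1" "H f (w, []) = vert_elem u (w, [])"
      by (auto simp: low_equal_def path_elem_def)
    then show "u = w" using uw f(1) by (auto simp: H_at_vertex path_elem_def split: if_splits)
  qed
  moreover have "\<sigma> ` {..<n} \<subseteq> {..<n}" using \<sigma> by auto
  ultimately show ?thesis by (simp add: bij_betw_def endo_inj_surj)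
qed

lemma \<sigma>_eq_iff: "u < n \<Longrightarrow> w < n \<Longrightarrow> \<sigma> u = \<sigma> w \<longleftrightarrow> u = w"
  using bij_\<sigma> by (auto simp: bij_betw_def inj_on_def)

section \<open>The map induced on arrows\<close>

text \<open>The matrix, in the basis of arrows, of the map induced on the arrow ideal modulo its
  square.\<close>

definition D :: "arrow \<Rightarrow> arrow \<Rightarrow> 'k" where
  "D a b = H (arrow_elem n a) (asrc n b, [b])"

text \<open>Multiply \<open>a\<close> by an end vertex, which fixes it. One term of the Leibniz rule
  drops out, and the other is \<open>D a b\<close> times the value of a character at an end of
  \<open>b\<close>.\<close>

lemma D_nonzero_imp:
  assumes "fst a < n" "fst b < n" "D a b \<noteq> 0"
  shows "asrc n a = \<sigma> (asrc n b)" "atgt n a = \<sigma> (atgt n b)"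
proof -
  have s: "asrc n a < n" "atgt n a < n" "asrc n b < n" "atgt n b < n" using assms asrc_less atgt_less by auto
  have "D a b = H (vert_elem (asrc n a)) (asrc n b, []) * D a b"
    using H_arrow(1)[OF vert_elem_closed[OF s(1)] arrow_elem_closed[OF assms(1)], of b] s assms
    by (simp add: vert_mult_path H_arrow_elem_vertex D_def)
  then show "asrc n a = \<sigma> (asrc n b)" using s assms(3) by (auto simp: H_vert_vertex split: if_splits)
  have "D a b = D a b * H (vert_elem (atgt n a)) (atgt n b, [])"
    using H_arrow(1)[OF arrow_elem_closed[OF assms(1)] vert_elem_closed[OF s(2)], of b] s assms
    by (simp add: arrow_mult_vert H_arrow_elem_vertex D_def)
  then show "atgt n a = \<sigma> (atgt n b)" using s assms(3) by (auto simp: H_vert_vertex split: if_splits)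
qed

text \<open>Surjectivity of the induced map: if no arrow reached \<open>b\<close>, the coefficient
  of \<open>b\<close> in \<open>H f\<close> would depend on the vertex part of \<open>f\<close>
  alone, but a preimage of \<open>b\<close> has no vertex part.\<close>

lemma D_nonzero_ex:
  assumes b: "fst b < n"
  shows "\<exists>a. fst a < n \<and> D a b \<noteq> 0"
proof (rule ccontr)
  assume "\<not> ?thesis"
  then have z: "H (arrow_elem n a) (asrc n b, [b]) = 0" if "fst a < n" for a using that by (auto simp: D_def)
  have sb: "asrc n b < n" "atgt n b < n" using b asrc_less atgt_less by auto
  have eq: "H f (asrc n b, [b]) = (\<Sum>v<n. f (v, []) * H (vert_elem v) (asrc n b, [b]))" if "f \<in> pa_carrier n" for f
    using that
  proof (induction f rule: pa_carrier_induct)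
    case zero
    show ?case by (simp add: H_zero)
  next
    case (add x c g)
    obtain v as where x: "x = (v, as)" by (cases x)
    have "H (path_elem x) (asrc n b, [b]) = (\<Sum>w<n. path_elem x (w, []) * H (vert_elem w) (asrc n b, [b]))"
    proof (cases as)
      case Nil
      have "(\<Sum>w<n. path_elem x (w, []) * H (vert_elem w) (asrc n b, [b])) =
          (\<Sum>w<n. if w = v then H (vert_elem w) (asrc n b, [b]) else 0)"
        by (rule sum.cong) (auto simp: x Nil path_elem_apply[of "(v, [])" "(_, _)"])
      then show ?thesis using add(1) by (simp add: x Nil)
    next
      case (Cons a bs)
      have a: "fst a < n" "asrc n a = v" "valid_path n (atgt n a, bs)"
        using add(1) by (auto simp: x Cons valid_path_Cons)
      have "H (path_elem x) (asrc n b, [b]) = 0"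
      proof (cases bs)
        case Nil
        then show ?thesis using z[OF a(1)] a(2) by (simp add: x Cons)
      next
        case (Cons a' cs)
        \<comment> \<open>A path of length at least two is a product of two elements whose images
          have no vertex part, so the Leibniz rule gives 0.\<close>
        then have "H (path_elem (atgt n a, bs)) (atgt n b, []) = 0"
          using H_path_vertex a(3) sb by auto
        then show ?thesis
          using H_arrow(1)[OF arrow_elem_closed[OF a(1)] path_elem_closed[OF a(3)], of b] sb a(1)
          by (simp add: x \<open>as = a # bs\<close> arrow_mult_path[OF a(2)] H_arrow_elem_vertex)
      qed
      moreover have "path_elem x (w, []) = (0 :: 'k)" for w by (simp add: x Cons path_elem_def)
      ultimately show ?thesis by simp
    qed
    then show ?case using add H_arrow(2)[OF path_elem_closed[OF add(1)] add(2)]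
      by (simp add: algebra_simps sum.distrib sum_distrib_left)
  qed
  from H_surj[OF arrow_elem_closed[OF b]] obtain f where f: "f \<in> pa_carrier n" "low_equal n p (H f) (arrow_elem n b)"
    by blast
  \<comment> \<open>As \<open>\<sigma>\<close> is onto, the characters test every vertex coefficient
    of \<open>f\<close>.\<close>
  have "f (v, []) = 0" if "v < n" for v
  proof -
    from that bij_\<sigma> obtain u where u: "u < n" "v = \<sigma> u" by (auto simp: bij_betw_def)
    then have "f (v, []) = H f (u, [])" using f(1) by (simp add: H_at_vertex)
    also have "\<dots> = 0" using f(2) by (simp add: low_equal_def path_elem_def)
    finally show ?thesis .
  qed
  then have "H f (asrc n b, [b]) = 0" by (simp add: eq[OF f(1)])
  moreover have "H f (asrc n b, [b]) = 1" using f(2) by (simp add: low_equal_def path_elem_def)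
  ultimately show False by simp
qed

text \<open>Some arrow has a nonzero coefficient at \<open>(i, False)\<close>, and it joins
  \<open>\<sigma> i\<close> to \<open>\<sigma> (vnext n i)\<close>.\<close>

lemma \<sigma>_neighbour:
  assumes "i < n"
  shows "\<sigma> (vnext n i) = vnext n (\<sigma> i) \<or> \<sigma> (vnext n i) = vprev n (\<sigma> i)"
proof -
  obtain a where a: "fst a < n" "D a (i, False) \<noteq> 0" using D_nonzero_ex[of "(i, False)"] assms by auto
  with D_nonzero_imp[OF a(1) _ a(2)] assms show ?thesis
    using vprev_vnext[of "fst a" n] by (cases a) (auto simp: asrc_eq atgt_eq split: if_splits)
qed

text \<open>The first step fixes the direction. A later reversal would repeat the value of
  \<open>\<sigma>\<close> from two steps before, against injectivity.\<close>

lemma \<sigma>_rotation_or_reflection: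
  "(\<forall>i<n. \<sigma> (vnext n i) = vnext n (\<sigma> i)) \<or> (\<forall>i<n. \<sigma> (vnext n i) = vprev n (\<sigma> i))"
proof -
  have no_return: "\<sigma> (vnext n (vnext n i)) \<noteq> \<sigma> i" if "i < n" for i
    using that vnext_vnext_neq[OF that n3] by (simp add: \<sigma>_eq_iff vnext_less)
  have next0: "vnext n i = Suc i" if "Suc i < n" for i using that by (simp add: vnext_if)
  show ?thesis
  proof (cases "\<sigma> (vnext n 0) = vnext n (\<sigma> 0)")
    case True
    have "\<sigma> (vnext n i) = vnext n (\<sigma> i)" if "i < n" for i
      using that
    proof (induction i)
      case (Suc i)
      then show ?case
        using \<sigma>_neighbour[of "Suc i"] no_return[of i] \<sigma>(1)[of i] vprev_vnext[of "\<sigma> i" n]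
        by (auto simp: next0)
    qed (rule True)
    then show ?thesis by blast
  next
    case False
    have "\<sigma> (vnext n i) = vprev n (\<sigma> i)" if "i < n" for i
      using that
    proof (induction i)
      case 0
      then show ?case using \<sigma>_neighbour[of 0] False by simp
    next
      case (Suc i)
      then show ?case
        using \<sigma>_neighbour[of "Suc i"] no_return[of i] \<sigma>(1)[of i] vnext_vprev[of "\<sigma> i" n]
        by (auto simp: next0)
    qed
    then show ?thesis by blast
  qed
qed

section \<open>Comparison of the relations in degree two\<close>

lemma loop_coeff_arrows:
  assumes "i < n" "fst a < n" "fst b < n"
  shows "loop_coeff n p i (H (pa_mult n (arrow_elem n a) (arrow_elem n b))) =
    p i * D a (i, False) * D b (i, True) + D a (vprev n i, True) * D b (vprev n i, False)"
proof -
  have "loop_coeff n p i (H (pa_mult n (arrow_elem n a) (arrow_elem n b))) =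
      loop_coeff n p i (pa_mult n (H (arrow_elem n a)) (H (arrow_elem n b)))"
    using H_mult[OF arrow_elem_closed[OF assms(2)] arrow_elem_closed[OF assms(3)]] assms(1)
    by (simp add: low_equal_def)
  then show ?thesis
    using assms by (simp add: loop_coeff_mult H_arrow_elem_vertex D_def asrc_eq vnext_vprev)
qed

text \<open>Both loops at \<open>j\<close> are products of two arrows, and the image of the relation
  at \<open>j\<close> is tested by \<open>loop_coeff\<close> at \<open>i\<close>. The case used is
  \<open>j = \<sigma> i\<close>.\<close>

lemma loop_relation:
  assumes "i < n" "j < n"
  shows "p i * D (j, False) (i, False) * D (j, True) (i, True)
      + D (j, False) (vprev n i, True) * D (j, True) (vprev n i, False) =
    q j * (p i * D (vprev n j, True) (i, False) * D (vprev n j, False) (i, True)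
      + D (vprev n j, True) (vprev n i, True) * D (vprev n j, False) (vprev n i, False))"
proof -
  let ?o = "path_elem (out_loop j) :: qpath \<Rightarrow> 'k" and ?i = "path_elem (in_loop n j) :: qpath \<Rightarrow> 'k"
  have o: "?o \<in> pa_carrier n" and i: "?i \<in> pa_carrier n" using assms(2) by (simp_all add: path_elem_closed valid_loops)
  have rel: "rel_elem n q j = (\<lambda>x. ?o x + (- q j) * ?i x)" by (simp add: rel_elem_eq)
  have "loop_coeff n p i (H (rel_elem n q j)) = 0"
    using H_rel[OF assms(2)] assms(1) by (simp add: low_equal_def) (simp add: loop_coeff_def)
  moreover have "loop_coeff n p i (H (rel_elem n q j)) =
      loop_coeff n p i (\<lambda>x. H ?o x + H (\<lambda>x. (- q j) * ?i x) x)"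
    using H_add[OF o pa_cmult_closed[OF i, of "- q j"]] assms(1) unfolding rel by (simp add: low_equal_def)
  moreover have "loop_coeff n p i (H (\<lambda>x. (- q j) * ?i x)) = loop_coeff n p i (\<lambda>x. (- q j) * H ?i x)"
    using H_cmult[OF i, of "- q j"] assms(1) by (simp add: low_equal_def)
  moreover have "loop_coeff n p i (\<lambda>x. f x + g x) = loop_coeff n p i f + loop_coeff n p i g"
    "loop_coeff n p i (\<lambda>x. - (c * f x)) = - (c * loop_coeff n p i f)" for f g c
    by (simp_all add: loop_coeff_def algebra_simps)
  ultimately have "loop_coeff n p i (H ?o) = q j * loop_coeff n p i (H ?i)" by simp
  then show ?thesis
    using assms vprev_less[OF n0(1)]
    unfolding out_loop_eq_mult[of j n] in_loop_eq_mult[OF assms(2)]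
    by (simp add: loop_coeff_arrows del: asrc.simps)
qed

lemma vnext_neq_vprev: "i < n \<Longrightarrow> vnext n i \<noteq> vprev n i"
  using vnext_vnext_neq[OF _ n3, of "vprev n i"] by (auto simp: vnext_vprev vprev_less n0)

text \<open>A rotation keeps the direction of arrows, so each relation compares
  \<open>?\<beta> i\<close> with \<open>?\<beta> (vprev n i)\<close>. In the product over
  \<open>i\<close> these nonzero factors cancel after reindexing.\<close>

lemma prod_rotation:
  assumes "\<forall>i<n. \<sigma> (vnext n i) = vnext n (\<sigma> i)"
  shows "(\<Prod>i<n. p i) = (\<Prod>i<n. q i)"
proof -
  let ?\<beta> = "\<lambda>i. D (\<sigma> i, False) (i, False) * D (\<sigma> i, True) (i, True)"
  have prev: "vprev n (\<sigma> i) = \<sigma> (vprev n i)" if "i < n" for i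
    using assms[rule_format, OF vprev_less[OF n0(1), of i]] that \<sigma>(1)[of "vprev n i"]
      vprev_vnext[of "\<sigma> (vprev n i)" n]
    by (simp add: vnext_vprev vprev_less n0)
  have nz: "?\<beta> i \<noteq> 0" if i: "i < n" for i
  proof -
    obtain a where a: "fst a < n" "D a (i, False) \<noteq> 0" using D_nonzero_ex[of "(i, False)"] i by auto
    \<comment> \<open>The ends of an arrow determine it, as there are no parallel arrows for
      \<open>n \<ge> 3\<close>.\<close>
    have "a = (\<sigma> i, False)"
      using arrow_forward[OF a(1) n3] D_nonzero_imp[OF a(1) _ a(2)] i assms by (simp add: asrc_eq atgt_eq)
    moreover obtain b where b: "fst b < n" "D b (i, True) \<noteq> 0" using D_nonzero_ex[of "(i, True)"] i by auto
    have "b = (\<sigma> i, True)"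
      using arrow_backward[OF b(1) n3] D_nonzero_imp[OF b(1) _ b(2)] i assms by (simp add: asrc_eq atgt_eq)
    ultimately show ?thesis using a b by simp
  qed
  have eq: "p i * ?\<beta> i = q (\<sigma> i) * ?\<beta> (vprev n i)" if i: "i < n" for i
  proof -
    \<comment> \<open>Entries that turn an arrow around vanish, because the targets do not match
      under \<open>\<sigma>\<close>.\<close>
    have "D (\<sigma> i, False) (vprev n i, True) = 0"
      using D_nonzero_imp(2)[of "(\<sigma> i, False)" "(vprev n i, True)"] i vnext_neq_vprev[OF i] \<sigma>(1)[OF i]
        assms[rule_format, OF i, symmetric]
      by (auto simp: atgt_eq vprev_less n0 \<sigma>_eq_iff vnext_less)
    moreover have "D (vprev n (\<sigma> i), True) (i, False) = 0"
      using D_nonzero_imp(2)[of "(vprev n (\<sigma> i), True)" "(i, False)"] i assms \<sigma>(1) vnext_neq_vprev[of "\<sigma> i"]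
      by (auto simp: atgt_eq vprev_less n0)
    ultimately show ?thesis
      using loop_relation[OF i \<sigma>(1)[OF i]] by (simp add: prev i algebra_simps)
  qed
  have "(\<Prod>i<n. p i) * (\<Prod>i<n. ?\<beta> i) = (\<Prod>i<n. q (\<sigma> i)) * (\<Prod>i<n. ?\<beta> (vprev n i))"
    unfolding prod.distrib[symmetric] by (rule prod.cong) (simp_all add: eq)
  also have "\<dots> = (\<Prod>i<n. q i) * (\<Prod>i<n. ?\<beta> i)"
    unfolding prod.reindex_bij_betw[OF bij_\<sigma>, of q] prod.reindex_bij_betw[OF bij_betw_vprev, of ?\<beta>] ..
  finally show ?thesis using nz by simp
qed

text \<open>A reflection turns arrows around, so the entries that keep the direction vanish and the
  two loops of the relation change places. This puts \<open>p i\<close> and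
  \<open>q (\<sigma> i)\<close> on the same side.\<close>

lemma prod_reflection:
  assumes "\<forall>i<n. \<sigma> (vnext n i) = vprev n (\<sigma> i)"
  shows "(\<Prod>i<n. p i) * (\<Prod>i<n. q i) = 1"
proof -
  \<comment> \<open>Arrows carry the index of the first end of their edge in cyclic order; for the
    image of the edge from \<open>i\<close> to \<open>vnext n i\<close> this is
    \<open>\<sigma> (vnext n i)\<close>.\<close>
  let ?\<gamma> = "\<lambda>i. D (\<sigma> (vnext n i), False) (i, True) * D (\<sigma> (vnext n i), True) (i, False)"
  have step_back: "vnext n (\<sigma> (vnext n i)) = \<sigma> i" if "i < n" for i
    using assms that \<sigma>(1) by (simp add: vnext_vprev)
  have nz: "?\<gamma> i \<noteq> 0" if i: "i < n" for i
  proof -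
    obtain a where a: "fst a < n" "D a (i, True) \<noteq> 0" using D_nonzero_ex[of "(i, True)"] i by auto
    have "a = (\<sigma> (vnext n i), False)"
      using arrow_forward[OF a(1) n3] D_nonzero_imp[OF a(1) _ a(2)] i step_back by (simp add: asrc_eq atgt_eq)
    moreover obtain b where b: "fst b < n" "D b (i, False) \<noteq> 0" using D_nonzero_ex[of "(i, False)"] i by auto
    have "b = (\<sigma> (vnext n i), True)"
      using arrow_backward[OF b(1) n3] D_nonzero_imp[OF b(1) _ b(2)] i step_back by (simp add: asrc_eq atgt_eq)
    ultimately show ?thesis using a b by simp
  qed
  have eq: "?\<gamma> (vprev n i) = q (\<sigma> i) * p i * ?\<gamma> i" if i: "i < n" for i
  proof -
    have n: "vnext n (\<sigma> i) = \<sigma> (vprev n i)" "vprev n (\<sigma> i) = \<sigma> (vnext n i)"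
      using step_back[of "vprev n i"] i assms by (simp_all add: vnext_vprev vprev_less n0)
    have "D (\<sigma> i, False) (i, False) = 0"
      using D_nonzero_imp(2)[of "(\<sigma> i, False)" "(i, False)"] i \<sigma>(1) vnext_neq_vprev[of "\<sigma> i"]
      by (auto simp: atgt_eq n)
    moreover have "D (\<sigma> (vnext n i), True) (vprev n i, True) = 0"
      using D_nonzero_imp(2)[of "(\<sigma> (vnext n i), True)" "(vprev n i, True)"] i \<sigma>(1) vnext_neq_vprev[of i]
      by (auto simp: atgt_eq vprev_less vnext_less n0 \<sigma>_eq_iff)
    ultimately show ?thesis
      using loop_relation[OF i \<sigma>(1)[OF i]] by (simp add: n(2) i algebra_simps vnext_vprev)
  qed
  have "(\<Prod>i<n. ?\<gamma> i) = (\<Prod>i<n. ?\<gamma> (vprev n i))"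
    unfolding prod.reindex_bij_betw[OF bij_betw_vprev, of ?\<gamma>] ..
  also have "\<dots> = (\<Prod>i<n. q (\<sigma> i)) * (\<Prod>i<n. p i) * (\<Prod>i<n. ?\<gamma> i)"
    unfolding prod.distrib[symmetric] by (rule prod.cong) (simp_all add: eq)
  also have "(\<Prod>i<n. q (\<sigma> i)) = (\<Prod>i<n. q i)"
    by (rule prod.reindex_bij_betw[OF bij_\<sigma>])
  finally show ?thesis using nz by (simp add: mult.commute)
qed

end

lemma A_iso_imp_prod:
  assumes "A_iso n q p" "3 \<le> n"
  shows "(\<Prod>i<n. p i) = (\<Prod>i<n. q i) \<or> (\<Prod>i<n. p i) * (\<Prod>i<n. q i) = 1"
proof -
  from A_iso_imp_lift[OF assms] obtain H where "low_degree_lift n p q H" ..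
  then interpret low_degree_lift n p q H .
  show ?thesis using \<sigma>_rotation_or_reflection prod_rotation prod_reflection by blast
qed

section \<open>Isomorphisms from quiver symmetries\<close>

lemma cmult_rel_ideal:
  assumes "f \<in> rel_ideal n p"
  shows "(\<lambda>x. c * f x) \<in> rel_ideal n p"
proof -
  interpret ideal "rel_ideal n p" "path_alg n" by (rule ideal_rel_ideal)
  show ?thesis
    using I_l_closed[OF assms, of "pa_scal n c"] Icarr[OF assms] by (simp add: pa_scal_closed pa_scal_mult)
qed

text \<open>The identity and a reflection are the instances, one for each of the two relations
  between the products.\<close>

locale quiver_involution =
  fixes n :: nat and \<nu> :: "nat \<Rightarrow> nat" and \<mu> :: "arrow \<Rightarrow> arrow"
  assumes \<nu>: "v < n \<Longrightarrow> \<nu> v < n" "v < n \<Longrightarrow> \<nu> (\<nu> v) = v"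
    and \<mu>: "fst a < n \<Longrightarrow> fst (\<mu> a) < n" "fst a < n \<Longrightarrow> \<mu> (\<mu> a) = a"
    and asrc_\<mu>: "fst a < n \<Longrightarrow> asrc n (\<mu> a) = \<nu> (asrc n a)"
    and atgt_\<mu>: "fst a < n \<Longrightarrow> atgt n (\<mu> a) = \<nu> (atgt n a)"
begin

definition flip :: "qpath \<Rightarrow> qpath" where
  "flip x = (\<nu> (fst x), map \<mu> (snd x))"

text \<open>Coefficients are pulled back along \<open>flip\<close>, so a path goes to a multiple of
  its flip and the weights sit on the arrows of the image. Invalid paths are cut off, since
  \<open>\<nu>\<close> and \<open>\<mu>\<close> are controlled only on the quiver.\<close>

definition twist :: "(arrow \<Rightarrow> 'k::field) \<Rightarrow> (qpath \<Rightarrow> 'k) \<Rightarrow> qpath \<Rightarrow> 'k" where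
  "twist w f x = (if valid_path n x then prod_list (map w (snd x)) * f (flip x) else 0)"

lemma valid_flip: "valid_path n x \<Longrightarrow> valid_path n (flip x)"
proof (cases x)
  case (Pair v as)
  have "valid_path n (v, as) \<Longrightarrow> valid_path n (flip (v, as))"
    by (induction as arbitrary: v) (auto simp: flip_def valid_path_Cons \<nu> \<mu> asrc_\<mu> atgt_\<mu>)
  then show "valid_path n x \<Longrightarrow> valid_path n (flip x)" by (simp add: Pair)
qed

lemma flip_flip:
  assumes "valid_path n x"
  shows "flip (flip x) = x"
proof -
  have "map (\<lambda>a. \<mu> (\<mu> a)) (snd x) = snd x"
    using assms by (intro map_idI) (auto simp: valid_path_def \<mu>(2))
  then show ?thesis using assms by (cases x) (auto simp: flip_def valid_path_def \<nu>(2) comp_def)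
qed

lemma twist_closed:
  assumes "f \<in> pa_carrier n"
  shows "twist w f \<in> pa_carrier n"
proof -
  have "{x. twist w f x \<noteq> 0} \<subseteq> flip ` {x. f x \<noteq> 0}"
    using flip_flip by (force simp: twist_def split: if_splits)
  moreover have "finite {x. f x \<noteq> 0}" using assms by (simp add: pa_carrier_def)
  ultimately have "finite {x. twist w f x \<noteq> 0}" by (meson finite_surj)
  then show ?thesis by (auto simp: pa_carrier_def twist_def split: if_splits)
qed

lemma twist_add: "twist w (\<lambda>x. f x + g x) = (\<lambda>x. twist w f x + twist w g x)"
  by (auto simp: twist_def algebra_simps)

lemma twist_cmult: "twist w (\<lambda>x. c * f x) = (\<lambda>x. c * twist w f x)"
  by (auto simp: twist_def)

lemma twist_one: "twist w (pa_one n) = pa_one n"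
  by (auto simp: twist_def pa_one_def flip_def \<nu> valid_path_def intro!: ext)

lemma twist_mult_valid:
  "valid_path n (v, as) \<Longrightarrow> twist w (pa_mult n f g) (v, as) = pa_mult n (twist w f) (twist w g) (v, as)"
proof (induction as arbitrary: v f)
  case Nil
  then show ?case by (simp add: twist_def flip_def)
next
  case (Cons a as)
  have a: "v < n" "fst a < n" "asrc n a = v" "valid_path n (atgt n a, as)"
    using Cons.prems by (auto simp: valid_path_Cons)
  \<comment> \<open>The left factor stripped of the flipped first arrow; its twist is the stripped
    twist of \<open>f\<close> up to the weight of \<open>a\<close>.\<close>
  let ?f = "\<lambda>x. f (\<nu> v, \<mu> a # snd x)"
  have "pa_mult n (\<lambda>x. twist w f (v, a # snd x)) (twist w g) (atgt n a, as) =
      pa_mult n (\<lambda>x. w a * twist w ?f x) (twist w g) (atgt n a, as)"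
    by (rule pa_mult_cong_left) (use a in \<open>auto simp: twist_def flip_def valid_path_Cons\<close>)
  also have "\<dots> = w a * twist w (pa_mult n ?f g) (atgt n a, as)"
    by (simp add: pa_mult_cmult_left Cons.IH[OF a(4)])
  finally have *: "pa_mult n (\<lambda>x. twist w f (v, a # snd x)) (twist w g) (atgt n a, as) =
      w a * twist w (pa_mult n ?f g) (atgt n a, as)" .
  show ?case
    unfolding pa_mult_Cons[of n "twist w f"] *
    using a Cons.prems by (simp add: twist_def flip_def pa_mult_Cons asrc_\<mu> atgt_\<mu> algebra_simps)
qed

lemma twist_mult:
  assumes "f \<in> pa_carrier n" "g \<in> pa_carrier n"
  shows "twist w (pa_mult n f g) = pa_mult n (twist w f) (twist w g)"
proof
  fix x
  show "twist w (pa_mult n f g) x = pa_mult n (twist w f) (twist w g) x"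
  proof (cases "valid_path n x")
    case True
    then show ?thesis by (cases x) (simp add: twist_mult_valid)
  next
    case False
    then show ?thesis
      using assms by (simp add: pa_carrier_invalid[OF pa_mult_closed] pa_carrier_invalid[OF twist_closed]
          pa_mult_closed twist_closed)
  qed
qed

lemma twist_twist:
  assumes "\<And>a. fst a < n \<Longrightarrow> w a * w' (\<mu> a) = 1" "f \<in> pa_carrier n"
  shows "twist w (twist w' f) = f"
proof
  fix x
  have "prod_list (map w as) * prod_list (map w' (map \<mu> as)) = 1" if "\<forall>a\<in>set as. fst a < n" for as
    using that
  proof (induction as)
    case (Cons a as)
    have eq: "prod_list (map w (a # as)) * prod_list (map w' (map \<mu> (a # as))) =
        (w a * w' (\<mu> a)) * (prod_list (map w as) * prod_list (map w' (map \<mu> as)))"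
      by (simp add: algebra_simps)
    have "w a * w' (\<mu> a) = 1" "prod_list (map w as) * prod_list (map w' (map \<mu> as)) = 1"
      using Cons assms(1) by auto
    then show ?case unfolding eq by simp
  qed simp
  then have "prod_list (map w (snd x)) * prod_list (map w' (snd (flip x))) = 1" if "valid_path n x"
    using that by (simp add: valid_path_def flip_def)
  then show "twist w (twist w' f) x = f x"
    using assms(2) by (auto simp: twist_def valid_flip flip_flip pa_carrier_invalid mult.assoc[symmetric])
qed

lemma twist_path_elem:
  assumes "valid_path n y"
  shows "twist w (path_elem y) = (\<lambda>x. prod_list (map w (snd (flip y))) * path_elem (flip y) x)"
proof
  fix x
  have "flip x = y \<longleftrightarrow> x = flip y" if "valid_path n x"
    using flip_flip[OF that] flip_flip[OF assms] by metis
  then show "twist w (path_elem y) x = prod_list (map w (snd (flip y))) * path_elem (flip y) x"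
    using valid_flip[OF assms] by (auto simp: twist_def path_elem_apply)
qed

lemma twist_ring_hom: "twist w \<in> ring_hom (path_alg n) (path_alg n)"
  by (rule ring_hom_memI) (simp_all add: twist_closed twist_mult twist_add twist_one)

text \<open>The preimage of an ideal under a homomorphism is an ideal, so generators
  suffice.\<close>

lemma twist_rel_ideal:
  assumes "\<And>i. i < n \<Longrightarrow> twist w (rel_elem n q i) \<in> rel_ideal n p" "f \<in> rel_ideal n q"
  shows "twist w f \<in> rel_ideal n p"
proof -
  interpret ring_hom_ring "path_alg n" "path_alg n" "twist w"
    by (rule ring_hom_ringI2[OF ring_path_alg ring_path_alg twist_ring_hom])
  have "rel_ideal n q \<subseteq> {f \<in> carrier (path_alg n). twist w f \<in> rel_ideal n p}"
    by (rule rel_ideal_minimal[OF ideal_vimage[OF ideal_rel_ideal]]) (auto simp: rel_elem_closed assms(1))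
  then show ?thesis using assms(2) by auto
qed

text \<open>The twist and its inverse carry the relations of one algebra to nonzero multiples of
  those of the other. The relation ideals thus correspond, and the first isomorphism theorem
  applies.\<close>

lemma A_iso_if_twist_rel:
  fixes q p :: "nat \<Rightarrow> 'k::field" and w :: "arrow \<Rightarrow> 'k"
  assumes w: "\<And>a. fst a < n \<Longrightarrow> w a \<noteq> 0"
    and rel: "\<And>i. i < n \<Longrightarrow> \<exists>c. c \<noteq> 0 \<and> twist w (rel_elem n q i) = (\<lambda>x. c * rel_elem n p (\<nu> i) x)"
  shows "A_iso n q p"
proof -
  let ?R = "path_alg n :: (qpath \<Rightarrow> 'k) ring"
  let ?I = "rel_ideal n q" and ?J = "rel_ideal n p"
  \<comment> \<open>Weights sit on the arrows of the image, so the inverse twist reads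
    \<open>w\<close> after flipping.\<close>
  let ?w' = "\<lambda>a. inverse (w (\<mu> a))"
  have inv1: "twist w (twist ?w' f) = f" if "f \<in> pa_carrier n" for f
    using that by (intro twist_twist) (auto simp: \<mu>(2) w)
  have inv2: "twist ?w' (twist w f) = f" if "f \<in> pa_carrier n" for f
    using that by (intro twist_twist) (auto simp: \<mu> w)
  have I: "twist w f \<in> ?J" if "f \<in> ?I" for f
  proof (rule twist_rel_ideal[OF _ that])
    fix i assume "i < n"
    from rel[OF this] obtain c where "twist w (rel_elem n q i) = (\<lambda>x. c * rel_elem n p (\<nu> i) x)" by blast
    then show "twist w (rel_elem n q i) \<in> ?J"
      using cmult_rel_ideal[OF rel_elem_in_rel_ideal[OF \<nu>(1)[OF \<open>i < n\<close>]], of c p] by simp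
  qed
  have J: "twist ?w' f \<in> ?I" if "f \<in> ?J" for f
  proof (rule twist_rel_ideal[OF _ that])
    fix j assume j: "j < n"
    then have i: "\<nu> j < n" by (rule \<nu>)
    from rel[OF this] obtain c where c: "c \<noteq> 0" "twist w (rel_elem n q (\<nu> j)) = (\<lambda>x. c * rel_elem n p j x)"
      using \<nu>(2)[OF j] by auto
    have "rel_elem n p j = (\<lambda>x. inverse c * twist w (rel_elem n q (\<nu> j)) x)"
      using c by (simp add: mult.assoc[symmetric])
    then have "twist ?w' (rel_elem n p j) = (\<lambda>x. inverse c * rel_elem n q (\<nu> j) x)"
      by (simp only: twist_cmult inv2[OF rel_elem_closed[OF i]])
    then show "twist ?w' (rel_elem n p j) \<in> ?I"
      by (simp add: cmult_rel_ideal rel_elem_in_rel_ideal i)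
  qed
  interpret I: ideal ?I ?R by (rule ideal_rel_ideal)
  interpret J: ideal ?J ?R by (rule ideal_rel_ideal)
  define \<phi> where "\<phi> = a_r_coset ?R ?J \<circ> twist w"
  interpret \<phi>: ring_hom_ring ?R "?R Quot ?J" \<phi>
    unfolding \<phi>_def
    by (rule ring_hom_ringI2[OF ring_path_alg J.quotient_is_ring ring_hom_trans[OF twist_ring_hom J.rcos_ring_hom]])
  have ker: "a_kernel ?R (?R Quot ?J) \<phi> = ?I"
  proof -
    have "\<phi> f = ?J \<longleftrightarrow> f \<in> ?I" if f: "f \<in> pa_carrier n" for f
    proof -
      have "\<phi> f = ?J \<longleftrightarrow> twist w f \<in> ?J"
        unfolding \<phi>_def using f J.rcos_const_imp_mem[of "twist w f"] J.a_rcos_const[of "twist w f"]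
        by (auto simp: twist_closed)
      also have "\<dots> \<longleftrightarrow> f \<in> ?I" using I[of f] J[of "twist w f"] inv2[OF f] by auto
      finally show ?thesis .
    qed
    then show ?thesis unfolding a_kernel_def' using I.Icarr by (auto simp: FactRing_def)
  qed
  have "\<phi> ` carrier ?R = carrier (?R Quot ?J)"
  proof -
    have "twist w ` pa_carrier n = pa_carrier n"
    proof
      show "pa_carrier n \<subseteq> twist w ` pa_carrier n"
      proof
        fix f :: "qpath \<Rightarrow> 'k" assume "f \<in> pa_carrier n"
        then show "f \<in> twist w ` pa_carrier n"
          using inv1[of f] twist_closed[of f ?w'] by (intro image_eqI[of _ _ "twist ?w' f"]) simp_all
      qed
    qed (use twist_closed in blast)
    then have "(a_r_coset ?R ?J \<circ> twist w) ` pa_carrier n = a_r_coset ?R ?J ` pa_carrier n"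
      by (metis image_comp)
    then show ?thesis unfolding FactRing_carrier \<phi>_def by simp
  qed
  from \<phi>.FactRing_iso_set[OF this] have "(\<lambda>X. the_elem (\<phi> ` X)) \<in> ring_iso (A_alg n q) (A_alg n p)"
    by (simp add: ker A_alg_def)
  moreover have "the_elem (\<phi> ` (?I +>\<^bsub>?R\<^esub> pa_scal n c)) = ?J +>\<^bsub>?R\<^esub> pa_scal n c" for c
    using \<phi>.the_elem_simp[of "pa_scal n c"]
    by (simp add: ker pa_scal_closed) (simp add: \<phi>_def pa_scal_def twist_cmult twist_one)
  ultimately show ?thesis unfolding A_iso_def by (intro exI conjI allI)
qed

end

section \<open>Scaling factors around the cycle\<close>

text \<open>Partial products solve the recursion. At 0 it asks for \<open>r 0\<close> times the last
  partial product, which is the full product and hence 1.\<close>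

lemma ex_cyclic_potential:
  fixes r :: "nat \<Rightarrow> 'k::field"
  assumes "(\<Prod>i<n. r i) = 1"
  shows "\<exists>\<alpha>. (\<forall>i<n. \<alpha> i \<noteq> 0) \<and> (\<forall>i<n. \<alpha> i = r i * \<alpha> (vprev n i))"
proof (intro exI conjI allI impI)
  let ?\<alpha> = "\<lambda>i. \<Prod>j\<le>i. r j"
  have nz: "r i \<noteq> 0" if "i < n" for i using assms that prod_zero[of "{..<n}" r] by auto
  show "?\<alpha> i \<noteq> 0" if "i < n" for i using nz that by auto
  show "?\<alpha> i = r i * ?\<alpha> (vprev n i)" if "i < n" for i
  proof (cases i)
    case 0
    have "{..n - 1} = {..<n}" using that by auto
    then show ?thesis using assms that by (simp add: 0 vprev_if)
  next
    case (Suc k)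
    then show ?thesis using that by (simp add: vprev_if)
  qed
qed

text \<open>Scale the unstarred arrows by \<open>b\<close> and keep the starred ones. The relation
  at \<open>i\<close> becomes \<open>b i\<close> times the one for \<open>p\<close> if
  \<open>q i * b (vprev n i) = b i * p i\<close>, which is solvable around the cycle because the
  products agree.\<close>

lemma A_iso_if_prod_eq:
  fixes p q :: "nat \<Rightarrow> 'k::field"
  assumes "\<forall>i<n. q i \<noteq> 0" "\<forall>i<n. p i \<noteq> 0" "(\<Prod>i<n. p i) = (\<Prod>i<n. q i)"
  shows "A_iso n q p"
proof -
  have "(\<Prod>i<n. q i / p i) = 1" using assms by (simp add: prod_dividef)
  then obtain b where b: "\<forall>i<n. b i \<noteq> 0" "\<forall>i<n. b i = q i / p i * b (vprev n i)"
    using ex_cyclic_potential by blast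
  interpret quiver_involution n id id by standard auto
  show ?thesis
  proof (rule A_iso_if_twist_rel)
    show "(case a of (i, s) \<Rightarrow> if s then 1 else b i) \<noteq> 0" if "fst a < n" for a
      using that b by (cases a) auto
  next
    fix i assume i: "i < n"
    let ?w = "\<lambda>(i, s). if s then 1 else b i"
    have "q i * b (vprev n i) = b i * p i" using b(2) i assms(2) by (simp add: field_simps)
    then have shift: "q i * (b (vprev n i) * z) = b i * (p i * z)" for z by (simp only: mult.assoc[symmetric])
    have "rel_elem n q i = (\<lambda>x. path_elem (out_loop i) x + (- q i) * path_elem (in_loop n i) x)"
      by (simp add: rel_elem_eq)
    then have "twist ?w (rel_elem n q i) = (\<lambda>x. b i * rel_elem n p (id i) x)"
      by (simp only: twist_add twist_cmult twist_path_elem valid_loops[OF i])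
        (simp add: flip_def out_loop_def in_loop_def rel_elem_eq algebra_simps shift)
    then show "\<exists>c. c \<noteq> 0 \<and> twist ?w (rel_elem n q i) = (\<lambda>x. c * rel_elem n p (id i) x)"
      using b(1) i by blast
  qed
qed

definition vneg :: "nat \<Rightarrow> nat \<Rightarrow> nat" where
  "vneg n i = (if i = 0 then 0 else n - i)"

lemma vneg_less: "i < n \<Longrightarrow> vneg n i < n"
  and vneg_vneg: "i < n \<Longrightarrow> vneg n (vneg n i) = i"
  by (auto simp: vneg_def)

lemma bij_betw_vneg: "bij_betw (vneg n) {..<n} {..<n}"
  by (rule bij_betw_byWitness[where f' = "vneg n"]) (auto simp: vneg_less vneg_vneg)

text \<open>The reflection sends the edge with index \<open>i\<close> to the edge from
  \<open>- i - 1\<close> to \<open>- i\<close> modulo \<open>n\<close>, whose index is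
  \<open>n - 1 - i\<close>: arrow indices and vertex indices are reflected differently.\<close>

lemma vprev_vneg: "i < n \<Longrightarrow> vprev n (vneg n i) = n - 1 - i"
  and vneg_vprev: "i < n \<Longrightarrow> n - 1 - vprev n i = vneg n i"
  by (auto simp: vneg_def vprev_if)

text \<open>The reflection exchanges the two loops. With the unstarred arrows scaled, the relation
  at \<open>i\<close> goes to a multiple of the one at \<open>j = vneg n i\<close> if
  \<open>b (vprev n j) = q i * b j * p j\<close>; this is the recursion with factors
  \<open>?r\<close>.\<close>

lemma A_iso_if_prod_inverse:
  fixes p q :: "nat \<Rightarrow> 'k::field"
  assumes "\<forall>i<n. q i \<noteq> 0" "\<forall>i<n. p i \<noteq> 0" "(\<Prod>i<n. p i) * (\<Prod>i<n. q i) = 1"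
  shows "A_iso n q p"
proof -
  let ?r = "\<lambda>i. inverse (p i * q (vneg n i))"
  have "(\<Prod>i<n. ?r i) = inverse ((\<Prod>i<n. p i) * (\<Prod>i<n. q (vneg n i)))"
    unfolding prod.distrib[symmetric] prod_inversef[symmetric] comp_def ..
  also have "(\<Prod>i<n. q (vneg n i)) = (\<Prod>i<n. q i)" by (rule prod.reindex_bij_betw[OF bij_betw_vneg])
  finally have "(\<Prod>i<n. ?r i) = 1" using assms(3) by simp
  from ex_cyclic_potential[OF this] obtain b
    where b: "\<forall>i<n. b i \<noteq> 0" "\<forall>i<n. b i = ?r i * b (vprev n i)" by blast
  interpret quiver_involution n "vneg n" "\<lambda>a. (n - 1 - fst a, \<not> snd a)"
  proof
    show "asrc n (n - 1 - fst a, \<not> snd a) = vneg n (asrc n a)" if "fst a < n" for a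
      using that by (cases a) (auto simp: asrc_eq vneg_def vnext_if)
    show "atgt n (n - 1 - fst a, \<not> snd a) = vneg n (atgt n a)" if "fst a < n" for a
      using that by (cases a) (auto simp: atgt_eq vneg_def vnext_if)
  qed (auto simp: vneg_less vneg_vneg)
  show ?thesis
  proof (rule A_iso_if_twist_rel)
    show "(case a of (i, s) \<Rightarrow> if s then 1 else b i) \<noteq> 0" if "fst a < n" for a
      using that b by (cases a) auto
  next
    fix i assume i: "i < n"
    let ?w = "\<lambda>(i, s). if s then 1 else b i" and ?j = "vneg n i"
    have j: "?j < n" "vneg n ?j = i" using i by (simp_all add: vneg_less vneg_vneg)
    have "b (vprev n ?j) = q i * b ?j * p ?j"
      using b(2) i j assms(1,2) by (simp add: field_simps)
    moreover have "rel_elem n q i = (\<lambda>x. path_elem (out_loop i) x + (- q i) * path_elem (in_loop n i) x)"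
      by (simp add: rel_elem_eq)
    moreover have "flip (out_loop i) = in_loop n ?j" "flip (in_loop n i) = out_loop ?j"
      unfolding flip_def out_loop_def in_loop_def by (simp_all add: vprev_vneg[OF i] vneg_vprev[OF i, simplified])
    ultimately have "twist ?w (rel_elem n q i) = (\<lambda>x. (- q i * b ?j) * rel_elem n p ?j x)"
      by (simp only: twist_add twist_cmult twist_path_elem valid_loops[OF i])
        (simp add: out_loop_def in_loop_def rel_elem_eq algebra_simps)
    then show "\<exists>c. c \<noteq> 0 \<and> twist ?w (rel_elem n q i) = (\<lambda>x. c * rel_elem n p ?j x)"
      using b(1) i j assms(1) by (intro exI[of _ "- q i * b ?j"]) auto
  qed
qed

lemma A_iso_iff_prod:
  fixes p q :: "nat \<Rightarrow> 'k::field"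
  assumes "3 \<le> n" "\<forall>i<n. q i \<noteq> 0" "\<forall>i<n. p i \<noteq> 0"
  shows "A_iso n q p \<longleftrightarrow> (\<Prod>i<n. p i) = (\<Prod>i<n. q i) \<or> (\<Prod>i<n. p i) * (\<Prod>i<n. q i) = 1"
  using assms A_iso_imp_prod A_iso_if_prod_eq A_iso_if_prod_inverse by blast

section \<open>The parametrization by cyclic potentials\<close>

lemma vprev_mod: "0 < n \<Longrightarrow> vprev n (x mod n) = (x + n - 1) mod n"
  using mod_add_left_eq[of x n "n - 1"] by (simp add: vprev_def)

lemma mod_if_le_double: "x \<le> 2 * n \<Longrightarrow> x mod n = (if x < n then x else if x < 2 * n then x - n else 0)" for x n :: nat
  by (auto simp: le_mod_geq)

text \<open>After reindexing, numerators and denominators have the same product, as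
  \<open>vprev n\<close> permutes the vertices.\<close>

lemma prod_shifted_potential:
  fixes \<alpha> :: "nat \<Rightarrow> 'k::field"
  assumes m: "bij_betw m {..<n} {..<n}" and nz: "\<forall>i<n. \<alpha> i \<noteq> 0"
  shows "(\<Prod>i<n. \<alpha> (vprev n (m i)) / \<alpha> (m i)) = 1"
proof -
  have "(\<Prod>i<n. \<alpha> (vprev n (m i)) / \<alpha> (m i)) = (\<Prod>i<n. \<alpha> (vprev n i) / \<alpha> i)"
    by (rule prod.reindex_bij_betw[OF m])
  also have "\<dots> = (\<Prod>i<n. \<alpha> (vprev n i)) / (\<Prod>i<n. \<alpha> i)" by (rule prod_dividef)
  also have "(\<Prod>i<n. \<alpha> (vprev n i)) = (\<Prod>i<n. \<alpha> i)" by (rule prod.reindex_bij_betw[OF bij_betw_vprev])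
  finally show ?thesis using nz by simp
qed

lemma bij_betw_shift:
  fixes k n :: nat
  assumes "k < n"
  shows "bij_betw (\<lambda>i. (i + k) mod n) {..<n} {..<n}"
proof -
  let ?m = "\<lambda>i. (i + k) mod n"
  have "inj_on ?m {..<n}"
    using assms by (intro inj_onI) (auto simp: mod_if_le_double split: if_splits)
  moreover have "?m ` {..<n} \<subseteq> {..<n}" using assms by auto
  ultimately show ?thesis by (simp add: bij_betw_def endo_inj_surj)
qed

text \<open>With \<open>2 * n\<close> in place of 0 the natural subtraction stays exact for all
  \<open>i\<close> and \<open>k\<close> below \<open>n\<close>.\<close>

lemma bij_betw_reflect:
  fixes k n :: nat
  assumes "k < n"
  shows "bij_betw (\<lambda>i. (2 * n - i - k) mod n) {..<n} {..<n}"
proof -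
  let ?m = "\<lambda>i. (2 * n - i - k) mod n"
  have "inj_on ?m {..<n}"
    using assms by (intro inj_onI) (auto simp: mod_if_le_double split: if_splits)
  moreover have "?m ` {..<n} \<subseteq> {..<n}" using assms by auto
  ultimately show ?thesis by (simp add: bij_betw_def endo_inj_surj)
qed

text \<open>Given equal products, take \<open>k = 0\<close> and solve for \<open>\<alpha>\<close>
  around the cycle. Conversely the quotients of \<open>\<alpha>\<close> have product 1 for every
  \<open>k\<close>.\<close>

lemma prod_eq_iff_potential:
  fixes p q :: "nat \<Rightarrow> 'k::field"
  assumes "0 < n" "\<forall>i<n. q i \<noteq> 0" "\<forall>i<n. p i \<noteq> 0"
  shows "(\<Prod>i<n. p i) = (\<Prod>i<n. q i) \<longleftrightarrow>
    (\<exists>\<alpha>. (\<forall>i<n. \<alpha> i \<noteq> 0) \<and> (\<exists>k<n. \<forall>i<n.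
       p i = \<alpha> ((i + k + n - 1) mod n) / \<alpha> ((i + k) mod n) * q ((i + k) mod n)))"
proof
  assume "(\<Prod>i<n. p i) = (\<Prod>i<n. q i)"
  then have "(\<Prod>i<n. q i / p i) = 1" using assms by (simp add: prod_dividef)
  then obtain \<alpha> where \<alpha>: "\<forall>i<n. \<alpha> i \<noteq> 0" "\<forall>i<n. \<alpha> i = q i / p i * \<alpha> (vprev n i)"
    using ex_cyclic_potential by blast
  have "p i = \<alpha> ((i + 0 + n - 1) mod n) / \<alpha> ((i + 0) mod n) * q ((i + 0) mod n)" if "i < n" for i
  proof -
    have "\<alpha> i * p i = q i * \<alpha> (vprev n i)" using \<alpha>(2) assms(3) that by (simp add: field_simps)
    then show ?thesis using \<alpha>(1) that by (simp add: vprev_def field_simps)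
  qed
  then show "\<exists>\<alpha>. (\<forall>i<n. \<alpha> i \<noteq> 0) \<and> (\<exists>k<n. \<forall>i<n.
       p i = \<alpha> ((i + k + n - 1) mod n) / \<alpha> ((i + k) mod n) * q ((i + k) mod n))"
    using \<alpha>(1) assms(1) by blast
next
  assume "\<exists>\<alpha>. (\<forall>i<n. \<alpha> i \<noteq> 0) \<and> (\<exists>k<n. \<forall>i<n.
       p i = \<alpha> ((i + k + n - 1) mod n) / \<alpha> ((i + k) mod n) * q ((i + k) mod n))"
  then obtain \<alpha> k where \<alpha>: "\<forall>i<n. \<alpha> i \<noteq> 0" and k: "k < n"
    and p: "\<forall>i<n. p i = \<alpha> ((i + k + n - 1) mod n) / \<alpha> ((i + k) mod n) * q ((i + k) mod n)" by blast
  let ?m = "\<lambda>i. (i + k) mod n"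
  have "(\<Prod>i<n. p i) = (\<Prod>i<n. \<alpha> (vprev n (?m i)) / \<alpha> (?m i)) * (\<Prod>i<n. q (?m i))"
    unfolding prod.distrib[symmetric] vprev_mod[OF assms(1)] by (rule prod.cong) (use p in auto)
  also have "\<dots> = (\<Prod>i<n. q i)"
    unfolding prod_shifted_potential[OF bij_betw_shift[OF k] \<alpha>] prod.reindex_bij_betw[OF bij_betw_shift[OF k], of q] by simp
  finally show "(\<Prod>i<n. p i) = (\<Prod>i<n. q i)" .
qed

lemma prod_inverse_iff_potential:
  fixes p q :: "nat \<Rightarrow> 'k::field"
  assumes "0 < n" "\<forall>i<n. q i \<noteq> 0" "\<forall>i<n. p i \<noteq> 0"
  shows "(\<Prod>i<n. p i) * (\<Prod>i<n. q i) = 1 \<longleftrightarrow>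
    (\<exists>\<alpha>. (\<forall>i<n. \<alpha> i \<noteq> 0) \<and> (\<exists>k<n. \<forall>i<n.
       p i = \<alpha> ((2 * n - i - k) mod n) / \<alpha> ((2 * n - i - k - 1) mod n) * inverse (q ((2 * n - i - k) mod n))))"
proof
  assume pq: "(\<Prod>i<n. p i) * (\<Prod>i<n. q i) = 1"
  have "(\<Prod>i<n. p (vneg n i)) = (\<Prod>i<n. p i)" by (rule prod.reindex_bij_betw[OF bij_betw_vneg])
  then have "(\<Prod>i<n. p (vneg n i) * q i) = 1" using pq by (simp add: prod.distrib)
  \<comment> \<open>At \<open>vneg n i\<close> this recursion involves \<open>p i\<close>, as the
    formula with \<open>k = 0\<close> demands.\<close>
  then obtain \<alpha> where \<alpha>: "\<forall>i<n. \<alpha> i \<noteq> 0" "\<forall>i<n. \<alpha> i = p (vneg n i) * q i * \<alpha> (vprev n i)"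
    using ex_cyclic_potential by blast
  have "p i = \<alpha> ((2 * n - i - 0) mod n) / \<alpha> ((2 * n - i - 0 - 1) mod n) * inverse (q ((2 * n - i - 0) mod n))"
    if i: "i < n" for i
  proof -
    let ?j = "vneg n i"
    have j: "?j < n" "vneg n ?j = i" using i by (simp_all add: vneg_less vneg_vneg)
    have "(2 * n - i) mod n = ?j" using i by (auto simp: mod_if_le_double vneg_def)
    moreover have "(2 * n - i - 1) mod n = vprev n ?j" using i by (auto simp: mod_if_le_double vprev_vneg)
    moreover have "\<alpha> ?j = p i * q ?j * \<alpha> (vprev n ?j)" using \<alpha>(2) j by metis
    moreover have "q ?j \<noteq> 0" "\<alpha> (vprev n ?j) \<noteq> 0" using \<alpha>(1) assms j(1) vprev_less by auto
    ultimately show ?thesis by (simp add: field_simps)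
  qed
  then show "\<exists>\<alpha>. (\<forall>i<n. \<alpha> i \<noteq> 0) \<and> (\<exists>k<n. \<forall>i<n.
       p i = \<alpha> ((2 * n - i - k) mod n) / \<alpha> ((2 * n - i - k - 1) mod n) * inverse (q ((2 * n - i - k) mod n)))"
    using \<alpha>(1) assms(1) by blast
next
  assume "\<exists>\<alpha>. (\<forall>i<n. \<alpha> i \<noteq> 0) \<and> (\<exists>k<n. \<forall>i<n.
       p i = \<alpha> ((2 * n - i - k) mod n) / \<alpha> ((2 * n - i - k - 1) mod n) * inverse (q ((2 * n - i - k) mod n)))"
  then obtain \<alpha> k where \<alpha>: "\<forall>i<n. \<alpha> i \<noteq> 0" and k: "k < n"
    and p: "\<forall>i<n. p i = \<alpha> ((2 * n - i - k) mod n) / \<alpha> ((2 * n - i - k - 1) mod n) *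
      inverse (q ((2 * n - i - k) mod n))" by blast
  let ?m = "\<lambda>i. (2 * n - i - k) mod n"
  have prev: "(2 * n - i - k - 1) mod n = vprev n (?m i)" if "i < n" for i
  proof -
    \<comment> \<open>\<open>2 * n - i - k\<close> is positive, so subtracting 1 before or after
      adding \<open>n\<close> is the same.\<close>
    have "2 * n - i - k + n - 1 = (2 * n - i - k - 1) + n" using that k by simp
    then show ?thesis unfolding vprev_mod[OF assms(1)] by simp
  qed
  have m: "?m i < n" for i using assms(1) by simp
  \<comment> \<open>The quotients of \<open>\<alpha>\<close> are inverse to those in
    \<open>p\<close>, so the factors cancel for each \<open>i\<close>.\<close>
  have "(\<Prod>i<n. p i) * (\<Prod>i<n. q (?m i)) * (\<Prod>i<n. \<alpha> (vprev n (?m i)) / \<alpha> (?m i)) = (\<Prod>i<n. 1)"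
    unfolding prod.distrib[symmetric]
  proof (rule prod.cong[OF refl])
    fix i assume "i \<in> {..<n}"
    then have i: "i < n" by simp
    have "p i = \<alpha> (?m i) / \<alpha> (vprev n (?m i)) * inverse (q (?m i))"
      using p i unfolding prev[OF i, symmetric] by blast
    moreover have "\<alpha> (?m i) \<noteq> 0" "\<alpha> (vprev n (?m i)) \<noteq> 0" "q (?m i) \<noteq> 0"
      using \<alpha> assms(2) m[of i] vprev_less[OF assms(1), of "?m i"] by blast+
    ultimately show "p i * q (?m i) * (\<alpha> (vprev n (?m i)) / \<alpha> (?m i)) = 1"
      by (simp only:) (simp add: field_simps)
  qed
  then show "(\<Prod>i<n. p i) * (\<Prod>i<n. q i) = 1"
    unfolding prod_shifted_potential[OF bij_betw_reflect[OF k] \<alpha>] prod.reindex_bij_betw[OF bij_betw_reflect[OF k], of q]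
    by simp
qed

theorem theorem2p8:
  fixes q p :: "nat \<Rightarrow> 'k::field_char_0" and n :: nat
  assumes "alg_closed TYPE('k)"
    and "n \<ge> 3"
    and "\<forall>i<n. q i \<noteq> 0" and "\<forall>i<n. p i \<noteq> 0"
  shows "A_iso n q p \<longleftrightarrow>
    (\<exists>\<alpha> :: nat \<Rightarrow> 'k. (\<forall>i<n. \<alpha> i \<noteq> 0) \<and> (\<exists>k<n.
       (\<forall>i<n. p i = \<alpha> ((i + k + n - 1) mod n) / \<alpha> ((i + k) mod n) * q ((i + k) mod n))
     \<or> (\<forall>i<n. p i = \<alpha> ((2 * n - i - k) mod n) / \<alpha> ((2 * n - i - k - 1) mod n)
                     * inverse (q ((2 * n - i - k) mod n)))))"
proof -
  have "0 < n" using assms(2) by simp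
  note iffs = prod_eq_iff_potential[OF this assms(3,4)] prod_inverse_iff_potential[OF this assms(3,4)]
  \<comment> \<open>Both cases share the quantifiers over \<open>\<alpha>\<close> and
    \<open>k\<close>, and these distribute over the disjunction.\<close>
  have ex_disj: "(\<exists>\<alpha>. A \<alpha> \<and> (\<exists>k<n. P \<alpha> k)) \<or> (\<exists>\<alpha>. A \<alpha> \<and> (\<exists>k<n. Q \<alpha> k)) \<longleftrightarrow>
      (\<exists>\<alpha>. A \<alpha> \<and> (\<exists>k<n. P \<alpha> k \<or> Q \<alpha> k))" for A :: "(nat \<Rightarrow> 'k) \<Rightarrow> bool" and P Q
    by blast
  show ?thesis
    unfolding A_iso_iff_prod[OF assms(2-4)] iffs by (rule ex_disj)
qed

end
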